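(* Let $\mathcal W$ be a Weyl graph of type $M$ with fundamental groupoid $\overline{\mathcal W}$. Then the metrization $$\delta:\overline{\mathcal W}\to W,\qquad [\gamma]\mapsto\gamma_W\quad(\gamma \text{ a geodesic}),$$ is a strict $W$-groupoid of type $M$.
   Context: Setting. $M=(m_{st})_{s,t\in S}$ is a Coxeter matrix on a finite set $S$, and $W=\langle S\mid (st)^{m_{st}}=1,\ m_{st}<\infty\rangle$ is its Coxeter group. A word over $S$ is reduced if no shorter word represents the same element of $W$. For $s\ne t$ let $p_m(s,t)=stst\cdots$ ($m$ letters), and if $m_{st}<\infty$ let $p(s,t)=p_{m_{st}}(s,t)$. Bruhat order on $W$: $u\le w$ if some reduced word for $w$ has a (not necessarily consecutive) subsequence which is a word for $u$. Groupoids are small and non-empty, with composition $g;h$ (or $gh$) written left to right, defined when $\tau(g)=\iota(h)$, where $\iota,\tau$ denote initial and terminal vertices. Weyl data. A generalized chamber system $\mathcal W$ of type $M$ is a set $\mathcal W_0$ of chambers with a family of groupoids $(\mathcal W_s)_{s\in S}$ (panel groupoids), each with vertex set $\mathcal W_0$. An edge of $\mathcal W$ of type $s$ is a non-identity edge of $\mathcal W_s$ (edges of different types are distinct). An $s$-panel is a connected component of $\mathcal W_s$. A gallery $\beta$ is a finite sequence of consecutive edges (a trivial gallery is a single chamber with no edges), with initial chamber $\iota(\beta)$, terminal chamber $\tau(\beta)$, type $\beta_S$ (the word of types of its edges), and $W$-length $\beta_W\in W$ (the element represented by $\beta_S$). It is a cycle if $\iota(\beta)=\tau(\beta)$, and a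 geodesic if $\beta_S$ is reduced. For $s\neq t$ with $m_{st}<\infty$: a maximal $(s,t)$-geodesic is a gallery of type $p(s,t)$; an $(s,t)$-cycle is a cycle of type $p_{2m_{st}}(s,t)$. Weyl data of type $M$ is a generalized chamber system of type $M$ together with, for each ordered pair $(s,t)$ with $s\neq t$, $m_{st}<\infty$, a set of $(s,t)$-cycles called defining suites. Homotopy. Elementary homotopies of galleries are the following moves on subgalleries and their inverses: delete $i\,i^{-1}$; replace $i\,i'$ ($i,i'$ of the same type, $i'\ne i^{-1}$) by the single edge $i;i'$; delete a defining suite. Galleries are homotopic ($\sim$) if related by finitely many such moves. The fundamental groupoid $\overline{\mathcal W}$ has vertices the chambers and edges the homotopy classes $[\beta]$ of galleries, with $[\beta];[\beta']=[\beta\beta']$. A pre-Weyl graph is Weyl data satisfying (PW0) no panel is a trivial groupoid (one vertex, one edge), and (PW1) each maximal $(s,t)$-geodesic is homotopic to a maximal $(t,s)$-geodesic. A Weyl graph is a pre-Weyl graph satisfying (W) homotopic geodesics have the same $W$-length. In a pre-Weyl graph every homotopy class of galleries contains a geodesic, so for a Weyl graph $\delta$ is defined on all edges of $\overline{\mathcal W}$ and is well defined. $W$-groupoids. A $W$-groupoid (of type $M$) on a groupoid $\mathcal G$ is a function $\delta$ from the edges of $\mathcal G$ to $W$ such that: (weak) for every vertex $C$ and every $s\in S$ there is an edge $g$ with $\iota(g)=C$ and $\delta(g)=s$; (WG1) $\delta(1)=1$ for all identity edges; (WG2) $\delta(gh)\ge\delta(g)\delta(h)$ in the Bruhat order whenever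 $gh$ is defined; (WG3) for every edge $g$ and $s\in S$ with $\delta(g)s<\delta(g)$ there is an edge $h$ with $\iota(h)=\iota(g)$, $\delta(h^{-1}g)=s$ and $\delta(h)=\delta(g)s$. It is strict if in addition $\delta(g)=1$ implies that $g$ is an identity edge. *)

theory Defs
  imports "HOL-Algebra.Group" "HOL-Library.Extended_Nat" "HOL-Library.Sublist"
begin

section \<open>Groups given by generators and relators\<close>

text \<open>A letter \<open>(s, True)\<close> stands for the generator \<open>s\<close> and \<open>(s, False)\<close> for its formal
  inverse.\<close>

type_synonym 's signed_word = "('s \<times> bool) list"

inductive pres_step :: "'s set \<Rightarrow> 's signed_word set \<Rightarrow> 's signed_word \<Rightarrow> 's signed_word \<Rightarrow> bool"
  for S R where
  cancel: "\<lbrakk>xs \<in> lists (S \<times> UNIV); ys \<in> lists (S \<times> UNIV); s \<in> S\<rbrakk>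
    \<Longrightarrow> pres_step S R (xs @ [(s, b), (s, \<not> b)] @ ys) (xs @ ys)"
| relator: "\<lbrakk>xs \<in> lists (S \<times> UNIV); ys \<in> lists (S \<times> UNIV); r \<in> R; r \<in> lists (S \<times> UNIV)\<rbrakk>
    \<Longrightarrow> pres_step S R (xs @ r @ ys) (xs @ ys)"

definition pres_class :: "'s set \<Rightarrow> 's signed_word set \<Rightarrow> 's signed_word \<Rightarrow> 's signed_word set" where
  "pres_class S R w = {v \<in> lists (S \<times> UNIV). equivclp (pres_step S R) w v}"

definition presented_group :: "'s set \<Rightarrow> 's signed_word set \<Rightarrow> 's signed_word set monoid" where
  "presented_group S R =
    \<lparr>carrier = pres_class S R ` lists (S \<times> UNIV),
     mult = (\<lambda>A B. \<Union>a\<in>A. \<Union>b\<in>B. pres_class S R (a @ b)),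
     one = pres_class S R []\<rparr>"


section \<open>Coxeter groups\<close>

locale coxeter_matrix =
  fixes S :: "'s set" and m :: "'s \<Rightarrow> 's \<Rightarrow> enat"
  assumes finite_S: "finite S"
    and m_diag: "s \<in> S \<Longrightarrow> m s s = 1"
    and m_sym: "\<lbrakk>s \<in> S; t \<in> S\<rbrakk> \<Longrightarrow> m s t = m t s"
    and m_ge_2: "\<lbrakk>s \<in> S; t \<in> S; s \<noteq> t\<rbrakk> \<Longrightarrow> m s t \<ge> 2"

definition coxeter_relators :: "'s set \<Rightarrow> ('s \<Rightarrow> 's \<Rightarrow> enat) \<Rightarrow> 's signed_word set" where
  "coxeter_relators S m =
    {concat (replicate n [(s, True), (t, True)]) | s t n. s \<in> S \<and> t \<in> S \<and> m s t = enat n}"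

definition coxeter_group :: "'s set \<Rightarrow> ('s \<Rightarrow> 's \<Rightarrow> enat) \<Rightarrow> 's signed_word set monoid" where
  "coxeter_group S m = presented_group S (coxeter_relators S m)"

definition word_elt :: "'s set \<Rightarrow> ('s \<Rightarrow> 's \<Rightarrow> enat) \<Rightarrow> 's list \<Rightarrow> 's signed_word set" where
  "word_elt S m ws = pres_class S (coxeter_relators S m) (map (\<lambda>s. (s, True)) ws)"

definition reduced :: "'s set \<Rightarrow> ('s \<Rightarrow> 's \<Rightarrow> enat) \<Rightarrow> 's list \<Rightarrow> bool" where
  "reduced S m ws \<longleftrightarrow> ws \<in> lists S \<and>
    \<not> (\<exists>vs \<in> lists S. length vs < length ws \<and> word_elt S m vs = word_elt S m ws)"

definition bruhat_le ::
  "'s set \<Rightarrow> ('s \<Rightarrow> 's \<Rightarrow> enat) \<Rightarrow> 's signed_word set \<Rightarrow> 's signed_word set \<Rightarrow> bool" where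
  "bruhat_le S m u w \<longleftrightarrow>
    (\<exists>ws us. reduced S m ws \<and> word_elt S m ws = w \<and> subseq us ws \<and> word_elt S m us = u)"

definition bruhat_less ::
  "'s set \<Rightarrow> ('s \<Rightarrow> 's \<Rightarrow> enat) \<Rightarrow> 's signed_word set \<Rightarrow> 's signed_word set \<Rightarrow> bool" where
  "bruhat_less S m u w \<longleftrightarrow> bruhat_le S m u w \<and> u \<noteq> w"

text \<open>The alternating word \<open>stst\<dots>\<close> with \<open>k\<close> letters.\<close>

fun alt_word :: "nat \<Rightarrow> 's \<Rightarrow> 's \<Rightarrow> 's list" where
  "alt_word 0 s t = []"
| "alt_word (Suc k) s t = s # alt_word k t s"


section \<open>Groupoids\<close>

text \<open>Composition is written left to right: \<open>gcomp G g h\<close> is \<open>g;h\<close>, which is meaningful only when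
  \<open>terminus G g = origin G h\<close>.\<close>

record ('v, 'e) groupoid =
  verts :: "'v set"
  edges :: "'e set"
  origin :: "'e \<Rightarrow> 'v"
  terminus :: "'e \<Rightarrow> 'v"
  gcomp :: "'e \<Rightarrow> 'e \<Rightarrow> 'e"
  gid :: "'v \<Rightarrow> 'e"

definition is_inverse_edge :: "('v, 'e) groupoid \<Rightarrow> 'e \<Rightarrow> 'e \<Rightarrow> bool" where
  "is_inverse_edge G g h \<longleftrightarrow> h \<in> edges G \<and> origin G h = terminus G g \<and> terminus G h = origin G g \<and>
    gcomp G g h = gid G (origin G g) \<and> gcomp G h g = gid G (terminus G g)"

definition ginv :: "('v, 'e) groupoid \<Rightarrow> 'e \<Rightarrow> 'e" where
  "ginv G g = (THE h. is_inverse_edge G g h)"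

locale groupoid =
  fixes G :: "('v, 'e) groupoid"
  assumes verts_nonempty: "verts G \<noteq> {}"
    and origin_in: "g \<in> edges G \<Longrightarrow> origin G g \<in> verts G"
    and terminus_in: "g \<in> edges G \<Longrightarrow> terminus G g \<in> verts G"
    and gid_in: "v \<in> verts G \<Longrightarrow> gid G v \<in> edges G"
    and origin_gid: "v \<in> verts G \<Longrightarrow> origin G (gid G v) = v"
    and terminus_gid: "v \<in> verts G \<Longrightarrow> terminus G (gid G v) = v"
    and gcomp_in: "\<lbrakk>g \<in> edges G; h \<in> edges G; terminus G g = origin G h\<rbrakk> \<Longrightarrow> gcomp G g h \<in> edges G"
    and origin_gcomp: "\<lbrakk>g \<in> edges G; h \<in> edges G; terminus G g = origin G h\<rbrakk>
      \<Longrightarrow> origin G (gcomp G g h) = origin G g"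
    and terminus_gcomp: "\<lbrakk>g \<in> edges G; h \<in> edges G; terminus G g = origin G h\<rbrakk>
      \<Longrightarrow> terminus G (gcomp G g h) = terminus G h"
    and gcomp_assoc: "\<lbrakk>g \<in> edges G; h \<in> edges G; k \<in> edges G;
        terminus G g = origin G h; terminus G h = origin G k\<rbrakk>
      \<Longrightarrow> gcomp G (gcomp G g h) k = gcomp G g (gcomp G h k)"
    and gid_gcomp: "g \<in> edges G \<Longrightarrow> gcomp G (gid G (origin G g)) g = g"
    and gcomp_gid: "g \<in> edges G \<Longrightarrow> gcomp G g (gid G (terminus G g)) = g"
    and inverse_ex: "g \<in> edges G \<Longrightarrow> \<exists>h. is_inverse_edge G g h"

definition connected_components :: "('v, 'e) groupoid \<Rightarrow> ('v, 'e) groupoid set" where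
  "connected_components G =
    (\<lambda>v. let U = {u. \<exists>e \<in> edges G. origin G e = v \<and> terminus G e = u}
      in G\<lparr>verts := U, edges := {e \<in> edges G. origin G e \<in> U \<and> terminus G e \<in> U}\<rparr>) ` verts G"

definition trivial_groupoid :: "('v, 'e) groupoid \<Rightarrow> bool" where
  "trivial_groupoid G \<longleftrightarrow> (\<exists>v e. verts G = {v} \<and> edges G = {e})"


section \<open>Weyl data and galleries\<close>

text \<open>An edge of type \<open>s\<close> is a pair \<open>(s, i)\<close>, so that edges of different types are distinct even
  though all panel groupoids share one edge type. A gallery is a pair of its initial chamber and
  its list of edges; the chamber is needed for the trivial galleries.\<close>

type_synonym ('s, 'c, 'e) gallery = "'c \<times> ('s \<times> 'e) list"

record ('s, 'c, 'e) weyl_data =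
  chambers :: "'c set"
  panel_groupoid :: "'s \<Rightarrow> ('c, 'e) groupoid"
  suites :: "'s \<Rightarrow> 's \<Rightarrow> ('s, 'c, 'e) gallery set"

definition cs_edges :: "'s set \<Rightarrow> ('s, 'c, 'e) weyl_data \<Rightarrow> ('s \<times> 'e) set" where
  "cs_edges S \<W> = {(s, i). s \<in> S \<and> i \<in> edges (panel_groupoid \<W> s) \<and>
    i \<notin> gid (panel_groupoid \<W> s) ` verts (panel_groupoid \<W> s)}"

fun is_path :: "'s set \<Rightarrow> ('s, 'c, 'e) weyl_data \<Rightarrow> 'c \<Rightarrow> ('s \<times> 'e) list \<Rightarrow> 'c \<Rightarrow> bool" where
  "is_path S \<W> c [] d \<longleftrightarrow> c \<in> chambers \<W> \<and> d = c"
| "is_path S \<W> c ((s, i) # es) d \<longleftrightarrow> (s, i) \<in> cs_edges S \<W> \<and>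
    origin (panel_groupoid \<W> s) i = c \<and> is_path S \<W> (terminus (panel_groupoid \<W> s) i) es d"

definition gallery :: "'s set \<Rightarrow> ('s, 'c, 'e) weyl_data \<Rightarrow> ('s, 'c, 'e) gallery \<Rightarrow> bool" where
  "gallery S \<W> \<beta> \<longleftrightarrow> (\<exists>d. is_path S \<W> (fst \<beta>) (snd \<beta>) d)"

definition gal_init :: "('s, 'c, 'e) gallery \<Rightarrow> 'c" where
  "gal_init \<beta> = fst \<beta>"

definition gal_term :: "('s, 'c, 'e) weyl_data \<Rightarrow> ('s, 'c, 'e) gallery \<Rightarrow> 'c" where
  "gal_term \<W> \<beta> = (case snd \<beta> of [] \<Rightarrow> fst \<beta>
    | _ \<Rightarrow> (case last (snd \<beta>) of (s, i) \<Rightarrow> terminus (panel_groupoid \<W> s) i))"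

definition gal_concat :: "('s, 'c, 'e) gallery \<Rightarrow> ('s, 'c, 'e) gallery \<Rightarrow> ('s, 'c, 'e) gallery" where
  "gal_concat \<beta> \<beta>' = (fst \<beta>, snd \<beta> @ snd \<beta>')"

definition gal_type :: "('s, 'c, 'e) gallery \<Rightarrow> 's list" where
  "gal_type \<beta> = map fst (snd \<beta>)"

definition W_length ::
  "'s set \<Rightarrow> ('s \<Rightarrow> 's \<Rightarrow> enat) \<Rightarrow> ('s, 'c, 'e) gallery \<Rightarrow> 's signed_word set" where
  "W_length S m \<beta> = word_elt S m (gal_type \<beta>)"

definition geodesic ::
  "'s set \<Rightarrow> ('s \<Rightarrow> 's \<Rightarrow> enat) \<Rightarrow> ('s, 'c, 'e) weyl_data \<Rightarrow> ('s, 'c, 'e) gallery \<Rightarrow> bool" where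
  "geodesic S m \<W> \<beta> \<longleftrightarrow> gallery S \<W> \<beta> \<and> reduced S m (gal_type \<beta>)"

definition max_geodesic ::
  "'s set \<Rightarrow> ('s \<Rightarrow> 's \<Rightarrow> enat) \<Rightarrow> ('s, 'c, 'e) weyl_data \<Rightarrow> 's \<Rightarrow> 's \<Rightarrow> ('s, 'c, 'e) gallery \<Rightarrow> bool"
where
  "max_geodesic S m \<W> s t \<beta> \<longleftrightarrow> gallery S \<W> \<beta> \<and> gal_type \<beta> = alt_word (the_enat (m s t)) s t"

definition st_cycle ::
  "'s set \<Rightarrow> ('s \<Rightarrow> 's \<Rightarrow> enat) \<Rightarrow> ('s, 'c, 'e) weyl_data \<Rightarrow> 's \<Rightarrow> 's \<Rightarrow> ('s, 'c, 'e) gallery \<Rightarrow> bool"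
where
  "st_cycle S m \<W> s t \<beta> \<longleftrightarrow> gallery S \<W> \<beta> \<and> gal_term \<W> \<beta> = gal_init \<beta> \<and>
    gal_type \<beta> = alt_word (2 * the_enat (m s t)) s t"

locale weyl_data = coxeter_matrix S m
  for S :: "'s set" and m :: "'s \<Rightarrow> 's \<Rightarrow> enat" +
  fixes \<W> :: "('s, 'c, 'e) weyl_data"
  assumes chambers_nonempty: "chambers \<W> \<noteq> {}"
    and panel_groupoid: "s \<in> S \<Longrightarrow> groupoid (panel_groupoid \<W> s)"
    and panel_verts: "s \<in> S \<Longrightarrow> verts (panel_groupoid \<W> s) = chambers \<W>"
    and suites_cycles: "\<lbrakk>s \<in> S; t \<in> S; s \<noteq> t; m s t < \<infinity>; \<beta> \<in> suites \<W> s t\<rbrakk>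
      \<Longrightarrow> st_cycle S m \<W> s t \<beta>"

text \<open>The values of \<open>suites \<W> s t\<close> for other pairs \<open>(s, t)\<close> are irrelevant.\<close>

definition defining_suites ::
  "'s set \<Rightarrow> ('s \<Rightarrow> 's \<Rightarrow> enat) \<Rightarrow> ('s, 'c, 'e) weyl_data \<Rightarrow> ('s, 'c, 'e) gallery set" where
  "defining_suites S m \<W> = {\<beta>. \<exists>s \<in> S. \<exists>t \<in> S. s \<noteq> t \<and> m s t < \<infinity> \<and> \<beta> \<in> suites \<W> s t}"


section \<open>Homotopy and the fundamental groupoid\<close>

inductive elem_homotopy ::
  "'s set \<Rightarrow> ('s \<Rightarrow> 's \<Rightarrow> enat) \<Rightarrow> ('s, 'c, 'e) weyl_data \<Rightarrow>
    ('s, 'c, 'e) gallery \<Rightarrow> ('s, 'c, 'e) gallery \<Rightarrow> bool"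
  for S m \<W> where
  delete_inverse: "\<lbrakk>gallery S \<W> (c, xs @ [(s, i), (s, i')] @ ys); i' = ginv (panel_groupoid \<W> s) i\<rbrakk>
    \<Longrightarrow> elem_homotopy S m \<W> (c, xs @ [(s, i), (s, i')] @ ys) (c, xs @ ys)"
| compose_edges: "\<lbrakk>gallery S \<W> (c, xs @ [(s, i), (s, i')] @ ys); i' \<noteq> ginv (panel_groupoid \<W> s) i\<rbrakk>
    \<Longrightarrow> elem_homotopy S m \<W> (c, xs @ [(s, i), (s, i')] @ ys)
          (c, xs @ [(s, gcomp (panel_groupoid \<W> s) i i')] @ ys)"
| delete_suite: "\<lbrakk>gallery S \<W> (c, xs @ snd \<omega> @ ys); gal_term \<W> (c, xs) = gal_init \<omega>;
      \<omega> \<in> defining_suites S m \<W>\<rbrakk>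
    \<Longrightarrow> elem_homotopy S m \<W> (c, xs @ snd \<omega> @ ys) (c, xs @ ys)"

definition homotopic ::
  "'s set \<Rightarrow> ('s \<Rightarrow> 's \<Rightarrow> enat) \<Rightarrow> ('s, 'c, 'e) weyl_data \<Rightarrow>
    ('s, 'c, 'e) gallery \<Rightarrow> ('s, 'c, 'e) gallery \<Rightarrow> bool" where
  "homotopic S m \<W> = equivclp (elem_homotopy S m \<W>)"

definition homotopy_class ::
  "'s set \<Rightarrow> ('s \<Rightarrow> 's \<Rightarrow> enat) \<Rightarrow> ('s, 'c, 'e) weyl_data \<Rightarrow>
    ('s, 'c, 'e) gallery \<Rightarrow> ('s, 'c, 'e) gallery set" where
  "homotopy_class S m \<W> \<beta> = {\<gamma>. gallery S \<W> \<gamma> \<and> homotopic S m \<W> \<beta> \<gamma>}"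

text \<open>Homotopies fix the end chambers, so \<open>origin\<close> and \<open>terminus\<close> below do not depend on the
  representative of a class.\<close>

definition fundamental_groupoid ::
  "'s set \<Rightarrow> ('s \<Rightarrow> 's \<Rightarrow> enat) \<Rightarrow> ('s, 'c, 'e) weyl_data \<Rightarrow>
    ('c, ('s, 'c, 'e) gallery set) groupoid" where
  "fundamental_groupoid S m \<W> =
    \<lparr>verts = chambers \<W>,
     edges = homotopy_class S m \<W> ` {\<beta>. gallery S \<W> \<beta>},
     origin = (\<lambda>X. THE c. \<exists>\<beta>\<in>X. gal_init \<beta> = c),
     terminus = (\<lambda>X. THE c. \<exists>\<beta>\<in>X. gal_term \<W> \<beta> = c),
     gcomp = (\<lambda>X Y. \<Union>\<beta>\<in>X. \<Union>\<beta>'\<in>Y. homotopy_class S m \<W> (gal_concat \<beta> \<beta>')),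
     gid = (\<lambda>c. homotopy_class S m \<W> (c, []))\<rparr>"


section \<open>Weyl graphs\<close>

locale pre_weyl_graph = weyl_data S m \<W>
  for S :: "'s set" and m :: "'s \<Rightarrow> 's \<Rightarrow> enat" and \<W> :: "('s, 'c, 'e) weyl_data" +
  assumes PW0: "\<lbrakk>s \<in> S; P \<in> connected_components (panel_groupoid \<W> s)\<rbrakk> \<Longrightarrow> \<not> trivial_groupoid P"
    and PW1: "\<lbrakk>s \<in> S; t \<in> S; s \<noteq> t; m s t < \<infinity>; max_geodesic S m \<W> s t \<gamma>\<rbrakk>
      \<Longrightarrow> \<exists>\<gamma>'. max_geodesic S m \<W> t s \<gamma>' \<and> homotopic S m \<W> \<gamma> \<gamma>'"

locale weyl_graph = pre_weyl_graph S m \<W>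
  for S :: "'s set" and m :: "'s \<Rightarrow> 's \<Rightarrow> enat" and \<W> :: "('s, 'c, 'e) weyl_data" +
  assumes W: "\<lbrakk>geodesic S m \<W> \<gamma>; geodesic S m \<W> \<gamma>'; homotopic S m \<W> \<gamma> \<gamma>'\<rbrakk>
      \<Longrightarrow> W_length S m \<gamma> = W_length S m \<gamma>'"

text \<open>In a Weyl graph every homotopy class contains a geodesic, and by (W) the \<open>W\<close>-length of such
  a geodesic is determined by the class.\<close>

definition metrization ::
  "'s set \<Rightarrow> ('s \<Rightarrow> 's \<Rightarrow> enat) \<Rightarrow> ('s, 'c, 'e) weyl_data \<Rightarrow>
    ('s, 'c, 'e) gallery set \<Rightarrow> 's signed_word set" where
  "metrization S m \<W> X = (THE w. \<exists>\<gamma>\<in>X. geodesic S m \<W> \<gamma> \<and> W_length S m \<gamma> = w)"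


section \<open>W-groupoids\<close>

locale W_groupoid = coxeter_matrix S m + groupoid G
  for S :: "'s set" and m :: "'s \<Rightarrow> 's \<Rightarrow> enat" and G :: "('v, 'e) groupoid" +
  fixes \<delta> :: "'e \<Rightarrow> 's signed_word set"
  assumes delta_in: "\<delta> \<in> edges G \<rightarrow> carrier (coxeter_group S m)"
    and weak: "\<lbrakk>C \<in> verts G; s \<in> S\<rbrakk> \<Longrightarrow> \<exists>g \<in> edges G. origin G g = C \<and> \<delta> g = word_elt S m [s]"
    and WG1: "v \<in> verts G \<Longrightarrow> \<delta> (gid G v) = \<one>\<^bsub>coxeter_group S m\<^esub>"
    and WG2: "\<lbrakk>g \<in> edges G; h \<in> edges G; terminus G g = origin G h\<rbrakk>
      \<Longrightarrow> bruhat_le S m (\<delta> g \<otimes>\<^bsub>coxeter_group S m\<^esub> \<delta> h) (\<delta> (gcomp G g h))"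
    and WG3: "\<lbrakk>g \<in> edges G; s \<in> S;
        bruhat_less S m (\<delta> g \<otimes>\<^bsub>coxeter_group S m\<^esub> word_elt S m [s]) (\<delta> g)\<rbrakk>
      \<Longrightarrow> \<exists>h \<in> edges G. origin G h = origin G g \<and>
            \<delta> (gcomp G (ginv G h) g) = word_elt S m [s] \<and>
            \<delta> h = \<delta> g \<otimes>\<^bsub>coxeter_group S m\<^esub> word_elt S m [s]"

locale strict_W_groupoid = W_groupoid S m G \<delta>
  for S :: "'s set" and m :: "'s \<Rightarrow> 's \<Rightarrow> enat" and G :: "('v, 'e) groupoid"
    and \<delta> :: "'e \<Rightarrow> 's signed_word set" +
  assumes strict: "\<lbrakk>g \<in> edges G; \<delta> g = \<one>\<^bsub>coxeter_group S m\<^esub>\<rbrakk> \<Longrightarrow> \<exists>v \<in> verts G. g = gid G v"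

end

theory Submission
  imports Defs Complex_Main
begin

text \<open>By Matsumoto's theorem, braid moves connect all reduced words of an element and bring every
  non-reduced word into a form with two equal consecutive letters. Braid moves on types lift to
  homotopies of galleries by (PW1). So every homotopy class contains a geodesic, and if
  \<open>\<delta>(g)s < \<delta>(g)\<close> then some geodesic in \<open>g\<close> ends with an edge of type \<open>s\<close>, which gives
  (WG3). For (WG2) the edges of a geodesic \<open>\<gamma>'\<close> are moved one by one to the end of a geodesic
  \<open>\<gamma>\<close>. An edge of type \<open>s\<close> is either appended, or cancelled, or absorbed by a last edge of type
  \<open>s\<close>. In the last case a product \<open>zy\<close> is replaced by \<open>zsy\<close> where \<open>zs > z\<close> and
  \<open>sy > y\<close>, and then \<open>zy\<close> arises from every word for \<open>zsy\<close> by deleting a letter. This holds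
  since the reflection \<open>zsz\<^sup>-\<^sup>1\<close> occurs an odd number of times in the reflection sequence
  of \<open>zsy\<close>.\<close>

section \<open>Words in the Coxeter generators\<close>

text \<open>The relators bound the order of a product st from above by \<open>m s t\<close>, but the
  word problem needs the order exactly: two different first letters s, t of reduced words for one
  element must force an alternating beginning of length \<open>m s t\<close>, and a contradiction if
  \<open>m s t = \<infinity>\<close>. The lower bound comes from a linear action of the group. The
  remaining Coxeter theory rests on the parity \<open>par\<close>, which descends to the group
  because every relator meets each reflection an even number of times. It yields strong exchange for
  arbitrary words.

  That generality matters for (WG2). After an absorption the word zsy need not be reduced, and the
  word for it at hand is an uncontrolled subsequence of the type of a geodesic. So a letter must be
  deletable from every word for zsy, not only from a reduced one.\<close>

lemma rev_in_lists_iff [simp]: "rev xs \<in> lists A \<longleftrightarrow> xs \<in> lists A"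
  by (auto simp: in_lists_conv_set)

lemma concat_replicate_in_lists: "r \<in> lists A \<Longrightarrow> concat (replicate n r) \<in> lists A"
  by (induction n) auto

lemma map_fst_in_lists: "a \<in> lists (A \<times> B) \<Longrightarrow> map fst a \<in> lists A"
  by (induction rule: lists.induct) auto

lemma equivclp_map:
  assumes "\<And>x y. r x y \<Longrightarrow> r' (f x) (f y)" "equivclp r a b"
  shows "equivclp r' (f a) (f b)"
  using assms(2)
proof (induction rule: equivclp_induct)
  case (step y z)
  then show ?case using assms(1) equivclp_into_equivclp by metis
qed auto

text \<open>The context of a \<open>pres_step\<close> must be a word over the generators. One factor
  is moved at a time, first with \<open>b\<close> as context and then with
  \<open>a'\<close>.\<close>

lemma pres_equiv_append:
  assumes "equivclp (pres_step S R) a a'" "equivclp (pres_step S R) b b'"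
    "a' \<in> lists (S \<times> UNIV)" "b \<in> lists (S \<times> UNIV)"
  shows "equivclp (pres_step S R) (a @ b) (a' @ b')"
proof -
  have "pres_step S R (x @ b) (y @ b)" if "pres_step S R x y" for x y
    using that
  proof cases
    case (cancel xs ys s c)
    then show ?thesis using pres_step.cancel[of xs S "ys @ b"] assms by simp
  next
    case (relator xs ys r)
    then show ?thesis using pres_step.relator[of xs S "ys @ b" r] assms by simp
  qed
  then have "equivclp (pres_step S R) (a @ b) (a' @ b)"
    by (rule equivclp_map[OF _ assms(1)])
  moreover have "pres_step S R (a' @ x) (a' @ y)" if "pres_step S R x y" for x y
    using that
  proof cases
    case (cancel xs ys s c)
    then show ?thesis using pres_step.cancel[of "a' @ xs" S ys] assms by simp
  next
    case (relator xs ys r)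
    then show ?thesis using pres_step.relator[of "a' @ xs" S ys r] assms by simp
  qed
  then have "equivclp (pres_step S R) (a' @ b) (a' @ b')"
    by (rule equivclp_map[OF _ assms(2)])
  ultimately show ?thesis by (rule equivclp_trans)
qed

lemma pres_class_eq_iff:
  assumes "u \<in> lists (S \<times> UNIV)" "v \<in> lists (S \<times> UNIV)"
  shows "pres_class S R u = pres_class S R v \<longleftrightarrow> equivclp (pres_step S R) u v"
proof
  assume "pres_class S R u = pres_class S R v"
  moreover have "v \<in> pres_class S R v" using assms by (simp add: pres_class_def)
  ultimately show "equivclp (pres_step S R) u v" by (auto simp: pres_class_def)
next
  assume "equivclp (pres_step S R) u v"
  then show "pres_class S R u = pres_class S R v"
    unfolding pres_class_def by (blast intro: equivclp_trans equivclp_sym)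
qed

context coxeter_matrix
begin

text \<open>Signs of letters play no role since \<open>m s s = 1\<close>, so equality in the Coxeter group can be
  described by unsigned words.\<close>

inductive cox_eq :: "'s list \<Rightarrow> 's list \<Rightarrow> bool" (infix "\<simeq>" 50) where
  refl: "u \<in> lists S \<Longrightarrow> u \<simeq> u"
| sym: "u \<simeq> v \<Longrightarrow> v \<simeq> u"
| trans [trans]: "u \<simeq> v \<Longrightarrow> v \<simeq> w \<Longrightarrow> u \<simeq> w"
| relator: "xs \<in> lists S \<Longrightarrow> ys \<in> lists S \<Longrightarrow> s \<in> S \<Longrightarrow> t \<in> S \<Longrightarrow> m s t = enat n
    \<Longrightarrow> xs @ concat (replicate n [s, t]) @ ys \<simeq> xs @ ys"

lemma cox_eq_in_lists: "u \<simeq> v \<Longrightarrow> u \<in> lists S \<and> v \<in> lists S"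
proof (induction rule: cox_eq.induct)
  case (relator xs ys s t n)
  then show ?case using concat_replicate_in_lists[of "[s, t]" S n] by simp
qed simp_all

lemma cox_eq_context: "u \<simeq> v \<Longrightarrow> xs \<in> lists S \<Longrightarrow> ys \<in> lists S \<Longrightarrow> xs @ u @ ys \<simeq> xs @ v @ ys"
proof (induction rule: cox_eq.induct)
  case (relator as bs s t n)
  show ?case
    using cox_eq.relator[of "xs @ as" "bs @ ys" s t n] relator by simp
next
  case (refl u)
  then show ?case by (intro cox_eq.refl) simp
qed (blast intro: cox_eq.sym cox_eq.trans)+

lemma cox_eq_append:
  assumes "u \<simeq> u'" "v \<simeq> v'"
  shows "u @ v \<simeq> u' @ v'"
proof (rule cox_eq.trans)
  show "u @ v \<simeq> u' @ v"
    using cox_eq_context[OF assms(1), of "[]" v] cox_eq_in_lists[OF assms(2)] by simp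
  show "u' @ v \<simeq> u' @ v'"
    using cox_eq_context[OF assms(2), of u' "[]"] cox_eq_in_lists[OF assms(1)] by simp
qed

text \<open>A relator (st)^n reverses to (ts)^n, again a relator because \<open>m\<close> is
  symmetric.\<close>

lemma cox_eq_rev: "u \<simeq> v \<Longrightarrow> rev u \<simeq> rev v"
proof (induction rule: cox_eq.induct)
  case (relator xs ys s t n)
  have "rev (concat (replicate n [s, t])) = concat (replicate n [t, s])"
    by (simp add: rev_concat)
  then show ?case
    using cox_eq.relator[of "rev ys" "rev xs" t s n] relator m_sym[of s t] by simp
next
  case (refl u)
  then show ?case by (intro cox_eq.refl) simp
qed (blast intro: cox_eq.sym cox_eq.trans)+

lemma cox_eq_square: "s \<in> S \<Longrightarrow> [s, s] \<simeq> []"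
  using relator[of "[]" "[]" s s 1] by (simp add: m_diag one_enat_def)

lemma cox_eq_rev_cancel: "u \<in> lists S \<Longrightarrow> u @ rev u \<simeq> []"
proof (induction u)
  case (Cons s u)
  then have "[s] @ (u @ rev u) @ [s] \<simeq> [s] @ [] @ [s]"
    by (intro cox_eq_context) auto
  also have "[s] @ [] @ [s] \<simeq> []" using Cons cox_eq_square[of s] by simp
  finally show ?case by simp
qed (simp add: cox_eq.refl)

lemma cox_eq_rev_cancel': "u \<in> lists S \<Longrightarrow> rev u @ u \<simeq> []"
  using cox_eq_rev_cancel[of "rev u"] by simp

lemma cox_eq_delete: "u \<simeq> [] \<Longrightarrow> xs \<in> lists S \<Longrightarrow> ys \<in> lists S \<Longrightarrow> xs @ u @ ys \<simeq> xs @ ys"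
  using cox_eq_context[of u "[]" xs ys] by simp

text \<open>Generators are involutions, so \<open>rev x\<close> represents the inverse of
  \<open>x\<close>.\<close>

lemma cox_eq_left_iff:
  assumes "x \<in> lists S" "u \<in> lists S" "v \<in> lists S"
  shows "x @ u \<simeq> v \<longleftrightarrow> u \<simeq> rev x @ v"
proof
  assume "x @ u \<simeq> v"
  then have "rev x @ x @ u \<simeq> rev x @ v"
    using assms by (intro cox_eq_append cox_eq.refl) auto
  moreover have "rev x @ x @ u \<simeq> u"
    using cox_eq_delete[OF cox_eq_rev_cancel', of x "[]" u] assms by simp
  ultimately show "u \<simeq> rev x @ v" by (meson cox_eq.sym cox_eq.trans)
next
  assume "u \<simeq> rev x @ v"
  then have "x @ u \<simeq> x @ rev x @ v"
    using assms by (intro cox_eq_append cox_eq.refl) auto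
  moreover have "x @ rev x @ v \<simeq> v"
    using cox_eq_delete[OF cox_eq_rev_cancel, of x "[]" v] assms by simp
  ultimately show "x @ u \<simeq> v" by (meson cox_eq.trans)
qed

lemma cox_eq_rev_iff: "rev u \<simeq> rev v \<longleftrightarrow> u \<simeq> v"
  using cox_eq_rev[of u v] cox_eq_rev[of "rev u" "rev v"] by auto

lemma cox_eq_right_iff:
  assumes "x \<in> lists S" "u \<in> lists S" "v \<in> lists S"
  shows "u @ x \<simeq> v \<longleftrightarrow> u \<simeq> v @ rev x"
  using cox_eq_left_iff[of "rev x" "rev u" "rev v"] assms
    cox_eq_rev_iff[of "u @ x" v] cox_eq_rev_iff[of u "v @ rev x"]
  by simp

lemma cox_eq_conj_iff:
  assumes "s \<in> S" "u \<in> lists S" "v \<in> lists S"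
  shows "s # u @ [s] \<simeq> v \<longleftrightarrow> u \<simeq> s # v @ [s]"
  using cox_eq_left_iff[of "[s]" "u @ [s]" v] cox_eq_right_iff[of "[s]" u "s # v"] assms by simp

text \<open>Forgetting signs turns the cancellation of formal inverses into the deletion of
  \<open>[s, s]\<close>, which is the relator for \<open>m s s = 1\<close>.\<close>

lemma pres_step_imp_cox_eq:
  "pres_step S (coxeter_relators S m) a b \<Longrightarrow> map fst a \<simeq> map fst b"
proof (induction rule: pres_step.induct)
  case (cancel xs ys s b)
  have "map fst xs @ [s, s] @ map fst ys \<simeq> map fst xs @ map fst ys"
    using cancel by (intro cox_eq_delete cox_eq_square map_fst_in_lists)
  then show ?case by simp
next
  case (relator xs ys r)
  then obtain s t n where "s \<in> S" "t \<in> S" "m s t = enat n"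
    "r = concat (replicate n [(s, True), (t, True)])"
    by (auto simp: coxeter_relators_def)
  moreover from this have "map fst r = concat (replicate n [s, t])"
    by (simp add: map_concat)
  ultimately show ?case
    using relator cox_eq.relator[of "map fst xs" "map fst ys" s t n]
    by (simp add: map_fst_in_lists)
qed

lemma pres_equiv_imp_cox_eq:
  assumes "a \<in> lists (S \<times> UNIV)" "equivclp (pres_step S (coxeter_relators S m)) a b"
  shows "map fst a \<simeq> map fst b"
  using assms(2)
proof (induction rule: equivclp_induct)
  case base
  then show ?case using assms(1) by (intro cox_eq.refl map_fst_in_lists)
next
  case (step y z)
  then show ?case by (meson cox_eq.sym cox_eq.trans pres_step_imp_cox_eq)
qed

lemma positive_word_in_lists:
  "u \<in> lists S \<Longrightarrow> map (\<lambda>s. (s, True)) u \<in> lists (S \<times> UNIV)"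
  by (auto simp: in_lists_conv_set)

text \<open>A relator step between unsigned words lifts to positive signed words, and forgetting
  signs undoes the lift.\<close>

lemma word_elt_eq_iff:
  assumes "u \<in> lists S" "v \<in> lists S"
  shows "word_elt S m u = word_elt S m v \<longleftrightarrow> u \<simeq> v"
proof -
  let ?R = "coxeter_relators S m" and ?p = "map (\<lambda>s. (s, True))"
  have "equivclp (pres_step S ?R) (?p x) (?p y)" if "x \<simeq> y" for x y
    using that
  proof (induction rule: cox_eq.induct)
    case (relator xs ys s t n)
    have "?p (concat (replicate n [s, t])) = concat (replicate n [(s, True), (t, True)])"
      by (simp add: map_concat)
    moreover have "concat (replicate n [(s, True), (t, True)]) \<in> ?R"
      using relator by (auto simp: coxeter_relators_def)
    moreover have "concat (replicate n [(s, True), (t, True)]) \<in> lists (S \<times> UNIV)"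
      using relator by (intro concat_replicate_in_lists) auto
    ultimately have "pres_step S ?R (?p (xs @ concat (replicate n [s, t]) @ ys)) (?p (xs @ ys))"
      using relator by (auto intro!: pres_step.relator simp: positive_word_in_lists)
    then show ?case by auto
  qed (auto intro: equivclp_trans equivclp_sym)
  moreover have "x \<simeq> y" if "equivclp (pres_step S ?R) (?p x) (?p y)" "x \<in> lists S" for x y
    using pres_equiv_imp_cox_eq[OF _ that(1)] positive_word_in_lists[OF that(2)]
    by (simp add: comp_def)
  ultimately show ?thesis
    using assms unfolding word_elt_def by (auto simp: pres_class_eq_iff positive_word_in_lists)
qed

text \<open>The product is a union over all pairs of representatives. Each pair gives the same class
  and both factors are non-empty, so the union is that class.\<close>

lemma word_elt_mult:
  assumes "u \<in> lists S" "v \<in> lists S"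
  shows "word_elt S m u \<otimes>\<^bsub>coxeter_group S m\<^esub> word_elt S m v = word_elt S m (u @ v)"
proof -
  let ?R = "coxeter_relators S m" and ?p = "map (\<lambda>s. (s, True))"
  let ?C = "pres_class S ?R"
  have "?C (a @ b) = ?C (?p u @ ?p v)" if "a \<in> ?C (?p u)" "b \<in> ?C (?p v)" for a b
    using that pres_equiv_append[of S ?R "?p u" a "?p v" b] assms
    by (subst pres_class_eq_iff)
      (auto simp: pres_class_def positive_word_in_lists intro: equivclp_sym)
  moreover have "?p u \<in> ?C (?p u)" "?p v \<in> ?C (?p v)"
    using assms by (auto simp: pres_class_def positive_word_in_lists)
  ultimately have "(\<Union>a\<in>?C (?p u). \<Union>b\<in>?C (?p v). ?C (a @ b)) = ?C (?p u @ ?p v)"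
    by blast
  then show ?thesis by (simp add: coxeter_group_def presented_group_def word_elt_def)
qed

lemma one_eq_word_elt: "\<one>\<^bsub>coxeter_group S m\<^esub> = word_elt S m []"
  by (simp add: coxeter_group_def presented_group_def word_elt_def)

lemma word_elt_in_carrier: "u \<in> lists S \<Longrightarrow> word_elt S m u \<in> carrier (coxeter_group S m)"
  by (auto simp: coxeter_group_def presented_group_def word_elt_def positive_word_in_lists)

section \<open>Reduced words\<close>

abbreviation red :: "'s list \<Rightarrow> bool" where "red \<equiv> reduced S m"

lemma red_in_lists: "red u \<Longrightarrow> u \<in> lists S"
  by (simp add: reduced_def)

lemma red_iff: "red u \<longleftrightarrow> u \<in> lists S \<and> (\<forall>v. v \<simeq> u \<longrightarrow> length u \<le> length v)"
proof -
  have "(v \<in> lists S \<and> word_elt S m v = word_elt S m u) \<longleftrightarrow> v \<simeq> u" if "u \<in> lists S" for v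
    using that cox_eq_in_lists word_elt_eq_iff by blast
  then show ?thesis unfolding reduced_def by (meson linorder_not_le)
qed

lemma red_cox_eq: assumes "red u" "v \<simeq> u" "length v = length u" shows "red v"
  unfolding red_iff
proof (intro conjI allI impI)
  show "v \<in> lists S" using cox_eq_in_lists assms(2) by blast
  fix w assume "w \<simeq> v"
  then have "w \<simeq> u" using assms(2) by (rule cox_eq.trans)
  then show "length v \<le> length w" using assms unfolding red_iff by simp
qed

lemma red_infix: assumes "red (xs @ u @ ys)" shows "red u"
  unfolding red_iff
proof (intro conjI allI impI)
  have l: "xs \<in> lists S" "u \<in> lists S" "ys \<in> lists S" using red_in_lists[OF assms] by auto
  then show "u \<in> lists S" by simp
  fix v assume "v \<simeq> u"
  then have "xs @ v @ ys \<simeq> xs @ u @ ys" using l by (intro cox_eq_context)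
  then show "length u \<le> length v" using assms unfolding red_iff by fastforce
qed

lemma red_ConsD: "red (s # u) \<Longrightarrow> red u"
  using red_infix[of "[s]" u "[]"] by simp

section \<open>Alternating words\<close>

lemma alt_word_snoc: "alt_word (Suc k) s t = alt_word k s t @ [if even k then s else t]"
  by (induction k arbitrary: s t) simp_all

lemma alt_word_even: "alt_word (2 * n) s t = concat (replicate n [s, t])"
  by (induction n) simp_all

lemma alt_word_add_even: "alt_word (2 * n + k) s t = alt_word (2 * n) s t @ alt_word k s t"
  by (induction n) simp_all

lemma length_alt_word [simp]: "length (alt_word k s t) = k"
  by (induction k arbitrary: s t) simp_all

lemma alt_word_in_lists: "s \<in> S \<Longrightarrow> t \<in> S \<Longrightarrow> alt_word k s t \<in> lists S"
  by (induction k arbitrary: s t) simp_all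

text \<open>The relator (st)^n cut in the middle: the inverse of its second half is the other side
  of the braid relation.\<close>

lemma alt_word_append_rev: "alt_word n s t @ rev (alt_word n t s) = alt_word (2 * n) s t"
proof (induction n arbitrary: s t)
  case (Suc n)
  have "alt_word (Suc n) s t @ rev (alt_word (Suc n) t s)
    = s # (alt_word n t s @ rev (alt_word n s t)) @ [t]" by simp
  also have "\<dots> = alt_word (2 * Suc n) s t"
    using Suc[of t s] alt_word_snoc[of "2 * n" t s] by simp
  finally show ?case .
qed simp

text \<open>Alternating words of odd length are the reflections of the dihedral subgroup. This form
  matches the conjugation in the recursion of \<open>par\<close>.\<close>

lemma alt_word_odd_conj: "alt_word (2 * Suc i + 1) s t = s # alt_word (2 * i + 1) t s @ [s]"
  using alt_word_snoc[of "2 * i + 1" t s] by simp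

text \<open>This is w a w^-1 for the alternating word w of length k and its next letter a, hence the
  reflection that the letter a contributes.\<close>

lemma alt_word_conj_last:
  "alt_word (Suc k) s t @ rev (alt_word k s t) = alt_word (2 * k + 1) s t"
  by (simp add: alt_word_append_rev)

lemma cox_eq_braid:
  assumes "s \<in> S" "t \<in> S" "m s t = enat n"
  shows "alt_word n s t \<simeq> alt_word n t s"
proof -
  have "alt_word n s t @ rev (alt_word n t s) \<simeq> []"
    using relator[of "[]" "[]" s t n] assms by (simp add: alt_word_append_rev alt_word_even)
  then show ?thesis
    using cox_eq_right_iff[of "rev (alt_word n t s)" "alt_word n s t" "[]"] assms
    by (simp add: alt_word_in_lists)
qed

section \<open>Reflections and the exchange condition\<close>

text \<open>Parity of the number of positions \<open>i\<close> in \<open>u = s\<^sub>1\<dots>s\<^sub>k\<close> at which the reflection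
  \<open>s\<^sub>1\<dots>s\<^sub>i\<dots>s\<^sub>1\<close> equals \<open>t\<close>.\<close>

primrec par :: "'s list \<Rightarrow> 's list \<Rightarrow> bool" where
  "par [] t = False"
| "par (s # u) t = (([s] \<simeq> t) \<noteq> par u (s # t @ [s]))"

lemma par_cong: "u \<in> lists S \<Longrightarrow> t \<simeq> t' \<Longrightarrow> par u t = par u t'"
proof (induction u arbitrary: t t')
  case (Cons s u)
  have "s # t @ [s] \<simeq> s # t' @ [s]"
    using cox_eq_context[of t t' "[s]" "[s]"] Cons by simp
  moreover have "[s] \<simeq> t \<longleftrightarrow> [s] \<simeq> t'" using Cons by (meson cox_eq.sym cox_eq.trans)
  ultimately show ?case using Cons by auto
qed simp

text \<open>A cocycle rule: the reflections contributed by \<open>v\<close> appear conjugated by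
  \<open>u\<close>.\<close>

lemma par_append: "par (u @ v) t = (par u t \<noteq> par v (rev u @ t @ u))"
  by (induction u arbitrary: t) auto

text \<open>The reflection at position i (counted from 0) is the alternating word of length 2i+1
  with the same first letter.\<close>

lemma par_alt_word:
  assumes "s \<in> S" "t \<in> S" "x \<in> lists S"
  shows "par (alt_word k s t) x = odd (\<Sum>i<k. of_bool (alt_word (2 * i + 1) s t \<simeq> x) :: nat)"
  using assms
proof (induction k arbitrary: s t x)
  case (Suc k)
  have "alt_word (2 * i + 1) t s \<simeq> s # x @ [s] \<longleftrightarrow> alt_word (2 * Suc i + 1) s t \<simeq> x" for i
    unfolding alt_word_odd_conj using Suc
    by (intro cox_eq_conj_iff[symmetric] alt_word_in_lists) auto
  then show ?case
    using Suc.IH[of t s "s # x @ [s]"] Suc.prems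
    unfolding sum.lessThan_Suc_shift by simp
qed simp

text \<open>The reflections at positions i and i+n of (st)^n differ by the relator itself, so the
  second half of the reflection sequence repeats the first.\<close>

lemma par_relator:
  assumes "s \<in> S" "t \<in> S" "m s t = enat n" "x \<in> lists S"
  shows "\<not> par (concat (replicate n [s, t])) x"
proof -
  define f where "f i = (of_bool (alt_word (2 * i + 1) s t \<simeq> x) :: nat)" for i
  have "f (i + n) = f i" for i
  proof -
    have "alt_word (2 * (i + n) + 1) s t = alt_word (2 * n) s t @ alt_word (2 * i + 1) s t"
      using alt_word_add_even[of n "2 * i + 1" s t] by (simp add: algebra_simps)
    moreover have "concat (replicate n [s, t]) @ alt_word (2 * i + 1) s t \<simeq> alt_word (2 * i + 1) s t"
      using relator[of "[]" "alt_word (2 * i + 1) s t" s t n] alt_word_in_lists[of s t "2 * i + 1"]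
        assms by simp
    ultimately have "alt_word (2 * (i + n) + 1) s t \<simeq> alt_word (2 * i + 1) s t"
      by (simp only: alt_word_even)
    then have "alt_word (2 * (i + n) + 1) s t \<simeq> x \<longleftrightarrow> alt_word (2 * i + 1) s t \<simeq> x"
      by (meson cox_eq.sym cox_eq.trans)
    then show ?thesis by (simp only: f_def)
  qed
  note period = this
  have "(\<Sum>i<k + n. f i) = (\<Sum>i<n. f i) + (\<Sum>i<k. f i)" for k
    by (induction k) (simp_all add: period)
  from this[of n] have "even (\<Sum>i<2 * n. f i)" by (simp flip: mult_2)
  then show ?thesis
    using par_alt_word[of s t x "2 * n"] assms by (simp add: f_def alt_word_even)
qed

text \<open>Deleting a relator r removes an even number of occurrences of each reflection, and
  conjugation by r leaves the later reflections unchanged in the group.\<close>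

lemma par_cox_eq: "u \<simeq> v \<Longrightarrow> x \<in> lists S \<Longrightarrow> par u x = par v x"
proof (induction arbitrary: x rule: cox_eq.induct)
  case (relator xs ys s t n)
  let ?r = "concat (replicate n [s, t])" and ?x = "rev xs @ x @ xs"
  have r: "?r \<in> lists S" "?r \<simeq> []"
    using relator cox_eq.relator[of "[]" "[]" s t n] concat_replicate_in_lists[of "[s, t]" S n]
    by simp_all
  have "rev ?r @ ?x @ ?r \<simeq> [] @ ?x @ []"
    using r cox_eq_rev[OF r(2)] relator by (intro cox_eq_append cox_eq.refl) auto
  then have "par ys (rev ?r @ ?x @ ?r) = par ys ?x"
    using relator by (intro par_cong) auto
  moreover have "\<not> par ?r ?x" using relator by (intro par_relator) auto
  ultimately show ?case by (simp add: par_append)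
next
  case (trans u v w)
  then show ?case by metis
qed simp_all

text \<open>Strong exchange: an odd count is not zero, so \<open>t\<close> is the reflection at some
  position of \<open>u\<close>, and multiplying by it deletes the letter there.\<close>

lemma exchange:
  "par u t \<Longrightarrow> u \<in> lists S \<Longrightarrow> t \<in> lists S \<Longrightarrow> \<exists>a s b. u = a @ s # b \<and> t @ u \<simeq> a @ b"
proof (induction u arbitrary: t)
  case (Cons s u)
  show ?case
  proof (cases "[s] \<simeq> t")
    case True
    then have "t @ s # u \<simeq> [s] @ s # u"
      using Cons by (intro cox_eq_append cox_eq.refl) (simp_all add: cox_eq.sym)
    also have "[s] @ s # u \<simeq> u"
      using cox_eq_delete[OF cox_eq_square, of s "[]" u] Cons by simp
    finally have "t @ s # u \<simeq> [] @ u" by simp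
    then show ?thesis by (metis append_Nil)
  next
    case False
    then have "par u (s # t @ [s])" using Cons by simp
    then obtain a r b where ab: "u = a @ r # b" "(s # t @ [s]) @ u \<simeq> a @ b"
      using Cons.IH[of "s # t @ [s]"] Cons.prems by auto
    then have "t @ s # u \<simeq> (s # a) @ b"
      using cox_eq_left_iff[of "[s]" "t @ s # u" "a @ b"] Cons.prems by simp
    then show ?thesis using ab by (metis append_Cons)
  qed
qed simp

text \<open>For t = x s x^-1 one has xs = tx. If t is counted in \<open>x\<close>, exchange shortens
  tx. Otherwise the appended letter makes the parity of t in xs odd, so every word for xs loses a
  letter to become a word for x and has length at least |x|+1.\<close>

lemma red_snoc_iff:
  assumes "red x" "s \<in> S"
  shows "red (x @ [s]) \<longleftrightarrow> \<not> par x (x @ s # rev x)"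
proof -
  let ?t = "x @ s # rev x"
  have l: "x \<in> lists S" using assms red_in_lists by blast
  then have t: "?t \<in> lists S" using assms by simp
  have del: "?t @ x @ ys \<simeq> x @ [s] @ ys" if "ys \<in> lists S" for ys
    using cox_eq_delete[OF cox_eq_rev_cancel', of x "x @ [s]" ys] l assms that by simp
  show ?thesis
  proof
    assume r: "red (x @ [s])"
    show "\<not> par x ?t"
    proof
      assume "par x ?t"
      then obtain a r' b where ab: "x = a @ r' # b" "?t @ x \<simeq> a @ b"
        using exchange t l by blast
      then have "a @ b \<simeq> x @ [s]" using del[of "[]"] by (simp, meson cox_eq.sym cox_eq.trans)
      then have "length (x @ [s]) \<le> length (a @ b)" using r unfolding red_iff by blast
      with ab(1) show False by simp
    qed
  next
    assume np: "\<not> par x ?t"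
    have "rev x @ ?t @ x \<simeq> [s]"
    proof -
      have "(rev x @ x) @ [s] @ (rev x @ x) \<simeq> [] @ [s] @ []"
        using l assms by (intro cox_eq_append cox_eq_rev_cancel' cox_eq.refl) auto
      then show ?thesis by simp
    qed
    \<comment> \<open>Conjugating t back by x gives s, so the last letter contributes exactly
      t.\<close>
    then have p: "par (x @ [s]) ?t" using np by (auto simp: par_append intro: cox_eq.sym)
    show "red (x @ [s])" unfolding red_iff
    proof (intro conjI allI impI)
      show "x @ [s] \<in> lists S" using l assms by simp
      fix v assume v: "v \<simeq> x @ [s]"
      have vl: "v \<in> lists S" using cox_eq_in_lists v by blast
      have "par v ?t" using par_cox_eq[OF v t] p by simp
      then obtain a r' b where ab: "v = a @ r' # b" "?t @ v \<simeq> a @ b"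
        using exchange t vl by blast
      have "?t @ v \<simeq> ?t @ x @ [s]" using v t by (intro cox_eq_append cox_eq.refl)
      also have "?t @ x @ [s] \<simeq> x @ [s, s]" using del[of "[s]"] assms by simp
      also have "x @ [s, s] \<simeq> x" using cox_eq_delete[OF cox_eq_square, of s x "[]"] l assms by simp
      finally have "a @ b \<simeq> x" using ab by (meson cox_eq.sym cox_eq.trans)
      then have "length x \<le> length (a @ b)" using assms unfolding red_iff by blast
      then show "length (x @ [s]) \<le> length v" using ab by simp
    qed
  qed
qed

text \<open>If the reflection s were counted in \<open>y\<close>, exchange would give a word for sy
  shorter than y.\<close>

lemma red_Cons_par: assumes "red (s # y)" shows "\<not> par y [s]"
proof
  assume p: "par y [s]"
  have l: "y \<in> lists S" "s \<in> S" using red_in_lists[OF assms] by auto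
  then obtain a r b where ab: "y = a @ r # b" "s # y \<simeq> a @ b"
    using exchange[OF p] by auto
  then show False using assms unfolding red_iff by (auto dest: cox_eq.sym)
qed

text \<open>A first letter of a reduced word is thus detected by \<open>par\<close>, which depends
  only on the element and so transfers to all its other words.\<close>

lemma par_Cons_red: assumes "red (s # y)" shows "par (s # y) [s]"
proof -
  have l: "y \<in> lists S" "s \<in> S" using red_in_lists[OF assms] by auto
  have "[s, s, s] \<simeq> [s]" using cox_eq_delete[OF cox_eq_square, of s "[]" "[s]"] l by simp
  then have "par y [s, s, s] = par y [s]" using l by (intro par_cong)
  then show ?thesis using red_Cons_par[OF assms] l by (auto intro: cox_eq.refl)
qed

text \<open>Since xs is not reduced, exchange deletes a letter of \<open>x\<close> to give a word
  for xs. Appending s returns to x without changing the length.\<close>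

lemma red_snocE:
  assumes "red x" "s \<in> S" "\<not> red (x @ [s])"
  obtains y where "red (y @ [s])" "y @ [s] \<simeq> x"
proof -
  let ?t = "x @ s # rev x"
  have l: "x \<in> lists S" using assms red_in_lists by blast
  have "par x ?t" using red_snoc_iff assms by blast
  then obtain a r b where ab: "x = a @ r # b" "?t @ x \<simeq> a @ b"
    using exchange[of x ?t] l assms by auto
  have "?t @ x \<simeq> x @ [s]"
    using cox_eq_delete[OF cox_eq_rev_cancel', of x "x @ [s]" "[]"] l assms by simp
  then have "x @ [s] \<simeq> a @ b" using ab by (meson cox_eq.sym cox_eq.trans)
  then have "(a @ b) @ [s] \<simeq> x"
    using cox_eq_right_iff[of "[s]" x "a @ b"] l assms(2) ab(1) by (simp add: cox_eq.sym)
  moreover from this have "red ((a @ b) @ [s])"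
    using ab by (intro red_cox_eq[OF assms(1)]) auto
  ultimately show ?thesis using that by blast
qed

text \<open>The reflection t = x s x^-1 has even count in x because xs is reduced, occurs at the
  middle letter, and has even count among the letters of y because sy is reduced. Its count in xsy,
  and so in any word \<open>v\<close> for it, is odd, and t xsy = xy.\<close>

lemma red_middle_delete:
  assumes "red (x @ [s])" "red (s # y)" "v \<simeq> x @ s # y"
  obtains a r b where "v = a @ r # b" "a @ b \<simeq> x @ y"
proof -
  have l: "x \<in> lists S" "y \<in> lists S" "s \<in> S"
    using red_in_lists[OF assms(1)] red_in_lists[OF assms(2)] by auto
  let ?t = "x @ s # rev x"
  have rx: "red x" using assms(1) red_infix[of "[]" x "[s]"] by simp
  have "\<not> par x ?t" using red_snoc_iff rx assms(1) l by blast
  moreover have "rev x @ ?t @ x \<simeq> [s]"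
  proof -
    have "(rev x @ x) @ [s] @ (rev x @ x) \<simeq> [] @ [s] @ []"
      using l by (intro cox_eq_append cox_eq_rev_cancel' cox_eq.refl) auto
    then show ?thesis by simp
  qed
  then have "par (s # y) (rev x @ ?t @ x) = par (s # y) [s]"
    using l by (intro par_cong) auto
  ultimately have "par (x @ s # y) ?t" using par_Cons_red[OF assms(2)] by (simp only: par_append) simp
  then have "par v ?t" using par_cox_eq[OF assms(3)] l by simp
  then obtain a r b where ab: "v = a @ r # b" "?t @ v \<simeq> a @ b"
    using exchange[of v ?t] cox_eq_in_lists[OF assms(3)] l by auto
  have "?t @ v \<simeq> ?t @ x @ s # y" using assms l by (intro cox_eq_append cox_eq.refl) auto
  also have "?t @ x @ s # y \<simeq> x @ [s, s] @ y"
    using cox_eq_delete[OF cox_eq_rev_cancel', of x "x @ [s]" "s # y"] l by simp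
  also have "x @ [s, s] @ y \<simeq> x @ y" using l by (intro cox_eq_delete cox_eq_square)
  finally have "a @ b \<simeq> x @ y" using ab(2) by (meson cox_eq.sym cox_eq.trans)
  then show ?thesis using ab(1) that by blast
qed

section \<open>The order of a product of two generators\<close>

text \<open>The dual of the geometric representation: a function \<open>f\<close> on \<open>S\<close> stands for a linear form
  with values \<open>f u\<close> on the simple roots. In contrast to the geometric representation itself, this
  needs no sums over \<open>S\<close>.\<close>

definition bil :: "'s \<Rightarrow> 's \<Rightarrow> real" where
  "bil s u = (if s = u then 2 else case m s u of enat n \<Rightarrow> - 2 * cos (pi / real n) | \<infinity> \<Rightarrow> - 2)"

text \<open>Composition of the linear form with the simple reflection that sends the root of u to
  itself minus \<open>bil s u\<close> times the root of s. Here \<open>bil\<close> is twice the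
  usual form, so its diagonal value is 2.\<close>

definition act :: "'s \<Rightarrow> ('s \<Rightarrow> real) \<Rightarrow> 's \<Rightarrow> real" where
  "act s f = (\<lambda>u. f u - bil s u * f s)"

lemma act_act: "act s (act s f) = f"
  by (auto simp: act_def bil_def fun_eq_iff)

abbreviation pair_power :: "nat \<Rightarrow> 's \<Rightarrow> 's \<Rightarrow> ('s \<Rightarrow> real) \<Rightarrow> 's \<Rightarrow> real" where
  "pair_power k s t \<equiv> foldr act (concat (replicate k [s, t]))"

text \<open>Both reflections change \<open>f\<close> only by multiples of \<open>bil s\<close> and
  \<open>bil t\<close>. This reduces the question whether \<open>f\<close> is fixed to its values at
  s and t.\<close>

lemma pair_power_span:
  "\<exists>x y. \<forall>u. pair_power k s t f u = f u - bil s u * x - bil t u * y"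
proof (induction k)
  case 0
  show ?case by (intro exI[of _ 0]) simp
next
  case (Suc k)
  define g where "g = pair_power k s t f"
  from Suc obtain x y where g: "\<forall>u. g u = f u - bil s u * x - bil t u * y"
    unfolding g_def by blast
  have "pair_power (Suc k) s t f u
      = f u - bil s u * (x + act t g s) - bil t u * (y + g t)" for u
  proof -
    have "pair_power (Suc k) s t f u = act s (act t g) u" by (simp add: g_def)
    also have "\<dots> = g u - bil t u * g t - bil s u * act t g s" by (simp add: act_def)
    also have "g u = f u - bil s u * x - bil t u * y" using g by blast
    finally show ?thesis by (simp add: algebra_simps)
  qed
  then show ?case by blast
qed

text \<open>The matrix of st on the values at s and t. It has determinant 1 and trace 4c^2 - 2,
  which is 2 cos(2\<theta>) for c = cos \<theta>.\<close>

lemma pair_power_step: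
  assumes "s \<noteq> t" "bil s t = - 2 * c" "bil t s = - 2 * c"
  shows "pair_power (Suc k) s t f s = - pair_power k s t f s - 2 * c * pair_power k s t f t"
    and "pair_power (Suc k) s t f t
      = 2 * c * pair_power k s t f s + (4 * c\<^sup>2 - 1) * pair_power k s t f t"
proof -
  have "bil s s = 2" "bil t t = 2" by (simp_all add: bil_def)
  then show "pair_power (Suc k) s t f s = - pair_power k s t f s - 2 * c * pair_power k s t f t"
    and "pair_power (Suc k) s t f t
      = 2 * c * pair_power k s t f s + (4 * c\<^sup>2 - 1) * pair_power k s t f t"
    using assms by (simp_all add: act_def algebra_simps power2_eq_square)
qed

lemma bil_finite:
  assumes "s \<in> S" "t \<in> S" "s \<noteq> t" "m s t = enat n"
  shows "bil s t = - 2 * cos (pi / n)" "bil t s = - 2 * cos (pi / n)"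
  using assms m_sym[of s t] by (simp_all add: bil_def)

lemma bil_infinite:
  assumes "s \<in> S" "t \<in> S" "s \<noteq> t" "m s t = \<infinity>"
  shows "bil s t = - 2 * 1" "bil t s = - 2 * 1"
  using assms m_sym[of s t] by (simp_all add: bil_def)

text \<open>The powers of a matrix with determinant 1 and trace 2 cos(2\<theta>) have entries
  sin(j\<theta>)/sin \<theta>. The factor \<open>sin \<theta>\<close> clears the
  denominator.\<close>

lemma pair_power_finite:
  assumes "s \<in> S" "t \<in> S" "s \<noteq> t" "m s t = enat n"
  defines "\<theta> \<equiv> pi / n"
  shows "sin \<theta> * pair_power k s t f s = - (sin ((2 * k - 1) * \<theta>) * f s + sin (2 * k * \<theta>) * f t)
    \<and> sin \<theta> * pair_power k s t f t = sin (2 * k * \<theta>) * f s + sin ((2 * k + 1) * \<theta>) * f t"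
proof (induction k)
  case 0
  show ?case by simp
next
  case (Suc k)
  define c where "c = cos \<theta>"
  define P Q where "P = pair_power k s t f s" and "Q = pair_power k s t f t"
  note step = pair_power_step[of s t c k f]
  have b: "bil s t = - 2 * c" "bil t s = - 2 * c"
    using bil_finite assms by (simp_all add: c_def)
  have rec: "sin (x + \<theta>) = 2 * c * sin x - sin (x - \<theta>)" for x
    by (simp add: c_def sin_add sin_diff)
  \<comment> \<open>The values sin((2k+j)\<theta>) obey a three-term recurrence in j. Indices -1, 0,
    1 describe the power k, and 1, 2, 3 the power k+1.\<close>
  define A where "A j = sin (2 * k * \<theta> + of_int j * \<theta>)" for j :: int
  have A: "A (j + 1) = 2 * c * A j - A (j - 1)" for j
    using rec[of "2 * k * \<theta> + of_int j * \<theta>"] by (simp add: A_def algebra_simps)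
  have A1: "A 1 = 2 * c * A 0 - A (-1)" and A2: "A 2 = 2 * c * A 1 - A 0"
    and A3: "A 3 = 2 * c * A 2 - A 1"
    using A[of 0] A[of 1] A[of 2] by simp_all
  have IH: "sin \<theta> * P = - (A (-1) * f s + A 0 * f t)" "sin \<theta> * Q = A 0 * f s + A 1 * f t"
    using Suc by (simp_all add: P_def Q_def A_def algebra_simps)
  have "sin \<theta> * pair_power (Suc k) s t f s = - (sin \<theta> * P) - 2 * c * (sin \<theta> * Q)"
    unfolding step(1)[OF assms(3) b] P_def Q_def by (simp add: algebra_simps)
  also have "\<dots> = - (A 1 * f s + A 2 * f t)" unfolding IH A2 A1 by (simp add: algebra_simps)
  finally have 1: "sin \<theta> * pair_power (Suc k) s t f s = - (A 1 * f s + A 2 * f t)" .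
  have "sin \<theta> * pair_power (Suc k) s t f t
      = 2 * c * (sin \<theta> * P) + (4 * c\<^sup>2 - 1) * (sin \<theta> * Q)"
    unfolding step(2)[OF assms(3) b] P_def Q_def by (simp add: algebra_simps)
  also have "\<dots> = A 2 * f s + A 3 * f t"
    unfolding IH A3 A2 A1 by (simp add: algebra_simps power2_eq_square)
  finally have 2: "sin \<theta> * pair_power (Suc k) s t f t = A 2 * f s + A 3 * f t" .
  have "A 1 = sin ((2 * real (Suc k) - 1) * \<theta>)" "A 2 = sin (2 * real (Suc k) * \<theta>)"
    "A 3 = sin ((2 * real (Suc k) + 1) * \<theta>)"
    by (simp_all add: A_def algebra_simps)
  with 1 2 show ?case by simp
qed

text \<open>The limit of the finite case for \<theta> tending to 0, where sin(j\<theta>)/sin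
  \<theta> tends to j.\<close>

lemma pair_power_infinite:
  assumes "s \<in> S" "t \<in> S" "s \<noteq> t" "m s t = \<infinity>"
  shows "pair_power k s t f s = - ((2 * k - 1) * f s + 2 * k * f t)
    \<and> pair_power k s t f t = 2 * k * f s + (2 * k + 1) * f t"
proof (induction k)
  case (Suc k)
  show ?case
    unfolding pair_power_step[OF assms(3) bil_infinite[OF assms]] conjunct1[OF Suc] conjunct2[OF Suc]
    by (simp add: algebra_simps)
qed simp

lemma sin_pi_div_pos: "sin (pi / real n) > 0" if "n \<ge> 2"
  using that by (intro sin_gt_zero) (auto simp: field_simps)

text \<open>For k = n the angles in the closed form are -\<theta>, 0 and \<theta> up to full turns,
  so the values at s and t return. By \<open>pair_power_span\<close> the rest of \<open>f\<close>
  then returns as well.\<close>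

lemma pair_power_relator:
  assumes "s \<in> S" "t \<in> S" "m s t = enat n"
  shows "pair_power n s t f = f"
proof (cases "s = t")
  case True
  then have "n = 1" using assms m_diag by (simp add: one_enat_def)
  then show ?thesis using True by (simp add: act_act)
next
  case False
  have "n \<ge> 2" using m_ge_2[of s t] assms False by (simp add: numeral_eq_enat)
  define \<theta> where "\<theta> = pi / n"
  have pos: "sin \<theta> > 0" using sin_pi_div_pos \<open>n \<ge> 2\<close> by (simp add: \<theta>_def)
  have n\<theta>: "n * \<theta> = pi" using \<open>n \<ge> 2\<close> by (simp add: \<theta>_def)
  then have angles: "(2 * real n - 1) * \<theta> = 2 * pi - \<theta>" "2 * real n * \<theta> = 2 * pi"
    "(2 * real n + 1) * \<theta> = 2 * pi + \<theta>"
    by (simp_all add: algebra_simps)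
  have "sin ((2 * real n - 1) * \<theta>) = - sin \<theta>" "sin (2 * real n * \<theta>) = 0"
    "sin ((2 * real n + 1) * \<theta>) = sin \<theta>"
    unfolding angles by (simp_all add: sin_diff sin_add)
  then have st: "pair_power n s t f s = f s" "pair_power n s t f t = f t"
    using pair_power_finite[OF assms(1,2) False assms(3), of n f] pos
    by (simp_all add: \<theta>_def[symmetric])
  obtain x y where xy: "\<And>u. pair_power n s t f u = f u - bil s u * x - bil t u * y"
    using pair_power_span by blast
  define c where "c = cos \<theta>"
  \<comment> \<open>The correction vanishes at s and t. The Gram matrix of these two roots is
    invertible because c^2 = 1 - sin^2 \<theta> is not 1.\<close>
  have "2 * x - 2 * c * y = 0" "2 * y - 2 * c * x = 0"
    using xy[of s] xy[of t] st bil_finite[OF assms(1,2) False assms(3)]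
    by (simp_all add: bil_def[of s s] bil_def[of t t] c_def \<theta>_def)
  then have "x = c * y" "y = c * x" by simp_all
  moreover have "(sin \<theta>)\<^sup>2 + c\<^sup>2 = 1" unfolding c_def by (rule sin_cos_squared_add)
  then have "c\<^sup>2 \<noteq> 1" using pos by auto
  ultimately have "x = 0" "y = 0"
    by (auto simp: power2_eq_square)
  then show ?thesis using xy by auto
qed

lemma act_cox_eq: "u \<simeq> v \<Longrightarrow> foldr act u f = foldr act v f"
proof (induction arbitrary: f rule: cox_eq.induct)
  case (relator xs ys s t n)
  then show ?case using pair_power_relator[of s t n "foldr act ys f"] by simp
qed simp_all

text \<open>This is the lower bound for the order of st. In the finite case a trivial power forces
  2k\<theta> to be a multiple of 2\<pi>, hence n to divide k. In the infinite case the entries grow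
  linearly in k.\<close>

lemma pair_power_nontrivial:
  assumes "s \<in> S" "t \<in> S" "s \<noteq> t" "0 < k" "enat k < m s t"
  shows "\<not> concat (replicate k [s, t]) \<simeq> []"
proof
  assume "concat (replicate k [s, t]) \<simeq> []"
  then have id: "pair_power k s t f = f" for f using act_cox_eq by fastforce
  \<comment> \<open>A form vanishing at s and equal to 1 at t isolates one column of the matrix of
    (st)^k.\<close>
  define f where "f u = (if u = t then 1 else 0 :: real)" for u
  have f: "f s = 0" "f t = 1" using assms by (simp_all add: f_def)
  show False
  proof (cases "m s t")
    case (enat n)
    define \<theta> where "\<theta> = pi / n"
    have "k < n" using enat assms by simp
    then have "sin \<theta> > 0" using sin_pi_div_pos[of n] assms by (simp add: \<theta>_def)
    moreover have "sin (2 * real k * \<theta>) = 0" "sin ((2 * real k + 1) * \<theta>) = sin \<theta>"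
      using pair_power_finite[OF assms(1-3) enat, of k f] f by (simp_all add: id \<theta>_def)
    moreover have "sin ((2 * real k + 1) * \<theta>)
        = sin (2 * real k * \<theta>) * cos \<theta> + cos (2 * real k * \<theta>) * sin \<theta>"
      by (simp add: distrib_right sin_add)
    ultimately have "cos (2 * real k * \<theta>) = 1" by simp
    then obtain j :: int where "2 * real k * \<theta> = of_int j * 2 * pi"
      unfolding cos_one_2pi_int by blast
    then have "real k = of_int j * real n"
      using \<open>k < n\<close> by (simp add: \<theta>_def field_simps)
    then have "int k = j * int n" by (metis of_int_eq_iff of_int_mult of_int_of_nat_eq)
    then have "int n dvd int k" by simp
    then have "n dvd k" by simp
    then show False using \<open>k < n\<close> assms(4) by (auto dest: dvd_imp_le)
  next
    case infinity
    then show False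
      using pair_power_infinite[OF assms(1-3) infinity, of k f] f assms by (simp add: id)
  qed
qed

text \<open>The quotient of the two reflections is (st)^(j-i) with 0 < j-i <
  \<open>m s t\<close>.\<close>

lemma alt_word_distinct_reflections:
  assumes "s \<in> S" "t \<in> S" "s \<noteq> t" "i < j" "enat j < m s t"
  shows "\<not> alt_word (2 * i + 1) s t \<simeq> alt_word (2 * j + 1) s t"
proof
  let ?w = "alt_word (2 * i + 1) s t" and ?r = "concat (replicate (j - i) [s, t])"
  assume "?w \<simeq> alt_word (2 * j + 1) s t"
  moreover have "alt_word (2 * j + 1) s t = ?r @ ?w"
  proof -
    have "2 * j + 1 = 2 * (j - i) + (2 * i + 1)" using assms(4) by simp
    then show ?thesis by (simp only: alt_word_add_even alt_word_even)
  qed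
  ultimately have "?r @ ?w \<simeq> ?w" by (auto intro: cox_eq.sym)
  moreover have l: "?w \<in> lists S" "?r \<in> lists S"
    using alt_word_in_lists[of s t "2 * i + 1"] concat_replicate_in_lists[of "[s, t]" S] assms by auto
  ultimately have "?r \<simeq> ?w @ rev ?w" using cox_eq_right_iff by blast
  then have "?r \<simeq> []" using cox_eq_rev_cancel[OF l(1)] by (rule cox_eq.trans)
  moreover have "enat (j - i) < m s t" using assms(5) by (rule le_less_trans[rotated]) simp
  ultimately show False using pair_power_nontrivial[of s t "j - i"] assms by simp
qed

text \<open>Each further letter contributes a reflection different from all earlier ones, so
  \<open>red_snoc_iff\<close> applies letter by letter.\<close>

lemma red_alt_word:
  assumes "s \<in> S" "t \<in> S" "s \<noteq> t" "enat k \<le> m s t"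
  shows "red (alt_word k s t)"
  using assms(4)
proof (induction k)
  case 0
  show ?case by (simp add: red_iff)
next
  case (Suc k)
  define a where "a = (if even k then s else t)"
  let ?w = "alt_word k s t"
  have kl: "enat k < m s t" using Suc.prems by (simp add: Suc_ile_eq)
  then have r: "red ?w" using Suc.IH by simp
  have w: "alt_word (Suc k) s t = ?w @ [a]" by (simp only: alt_word_snoc a_def)
  have conj: "?w @ a # rev ?w = alt_word (2 * k + 1) s t"
    using alt_word_conj_last[of k s t] unfolding w by simp
  have "\<not> alt_word (2 * i + 1) s t \<simeq> alt_word (2 * k + 1) s t" if "i < k" for i
    using alt_word_distinct_reflections assms that kl by blast
  then have "(\<Sum>i<k. of_bool (alt_word (2 * i + 1) s t \<simeq> alt_word (2 * k + 1) s t) :: nat) = 0"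
    by simp
  then have "\<not> par ?w (alt_word (2 * k + 1) s t)"
    using par_alt_word[of s t "alt_word (2 * k + 1) s t" k] alt_word_in_lists[of s t "2 * k + 1"] assms
    by simp
  moreover have "a \<in> S" using assms by (simp add: a_def)
  ultimately show ?case using red_snoc_iff[OF r] conj w by simp
qed

section \<open>The word problem\<close>

inductive braid :: "'s list \<Rightarrow> 's list \<Rightarrow> bool" where
  refl: "u \<in> lists S \<Longrightarrow> braid u u"
| step: "braid u (xs @ alt_word n s t @ ys) \<Longrightarrow> s \<in> S \<Longrightarrow> t \<in> S \<Longrightarrow> s \<noteq> t \<Longrightarrow> m s t = enat n
    \<Longrightarrow> braid u (xs @ alt_word n t s @ ys)"

lemma braid_trans: "braid v w \<Longrightarrow> braid u v \<Longrightarrow> braid u w"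
  by (induction rule: braid.induct) (blast intro: braid.step)+

lemma braid_context:
  assumes "braid u v" "xs \<in> lists S" "ys \<in> lists S"
  shows "braid (xs @ u @ ys) (xs @ v @ ys)"
  using assms(1)
proof (induction rule: braid.induct)
  case (refl u)
  then show ?case using assms by (intro braid.refl) simp
next
  case (step u as n s t bs)
  then show ?case using braid.step[of "xs @ u @ ys" "xs @ as" n s t "bs @ ys"] by simp
qed

lemma length_braid: "braid u v \<Longrightarrow> length v = length u"
  by (induction rule: braid.induct) simp_all

text \<open>The alternating beginning grows by one letter per step. If it starts with a, then b is
  also a left descent of w and can be put in front, at the cost of a letter elsewhere. The starting
  letter flips each time, hence only the set {a, b} is fixed.\<close>

lemma common_descents:
  assumes "s \<in> S" "t \<in> S" "s \<noteq> t" "red w" "par w [s]" "par w [t]" "enat k \<le> m s t"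
  shows "\<exists>y a b. {a, b} = {s, t} \<and> red (alt_word k a b @ y) \<and> alt_word k a b @ y \<simeq> w
    \<and> length (alt_word k a b @ y) = length w"
  using assms(7)
proof (induction k)
  case 0
  have "alt_word 0 s t @ w \<simeq> w" using assms red_in_lists by (simp add: cox_eq.refl)
  then show ?case using assms by (metis alt_word.simps(1) append_Nil)
next
  case (Suc k)
  have "enat k \<le> m s t" using Suc.prems by (meson Suc_ile_eq less_imp_le)
  then obtain y a b where y: "{a, b} = {s, t}" "red (alt_word k a b @ y)"
    "alt_word k a b @ y \<simeq> w" "length (alt_word k a b @ y) = length w"
    using Suc.IH by blast
  let ?A = "alt_word k a b"
  have ab: "a \<in> S" "b \<in> S" "a \<noteq> b" "par w [b]" "m a b = m s t"
    using y(1) assms m_sym by (auto simp: doubleton_eq_iff)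
  have yl: "y \<in> lists S" "?A \<in> lists S" using red_in_lists[OF y(2)] by auto
  \<comment> \<open>Because bA is reduced, the reflection b has even count in A, so exchange deletes
    a letter of y and keeps A intact.\<close>
  have "red (b # ?A)"
    using red_alt_word[of b a "Suc k"] Suc.prems ab m_sym[of a b] by simp
  then have "\<not> par ?A [b]" by (rule red_Cons_par)
  moreover have "par (?A @ y) [b]" using par_cox_eq[OF y(3), of "[b]"] ab by simp
  ultimately have "par y (rev ?A @ [b] @ ?A)" by (simp add: par_append)
  moreover have "rev ?A @ [b] @ ?A \<in> lists S" using yl ab by simp
  ultimately obtain c r d where cd: "y = c @ r # d" "(rev ?A @ [b] @ ?A) @ y \<simeq> c @ d"
    using exchange yl(1) by blast
  then have cdl: "c @ d \<in> lists S" using yl by simp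
  have "b # ?A @ y \<simeq> ?A @ c @ d"
    using cox_eq_left_iff[of "rev ?A" "b # ?A @ y" "c @ d"] cd(2) cdl yl ab by simp
  then have "?A @ y \<simeq> (b # ?A) @ c @ d"
    using cox_eq_left_iff[of "[b]" "?A @ y" "?A @ c @ d"] cdl yl ab by simp
  then have "alt_word (Suc k) b a @ c @ d \<simeq> w"
    using y(3) by simp (meson cox_eq.sym cox_eq.trans)
  moreover have "length (alt_word (Suc k) b a @ c @ d) = length w"
    using y(4) cd(1) by simp
  moreover from calculation have "red (alt_word (Suc k) b a @ c @ d)"
    using red_cox_eq assms(4) by blast
  moreover have "{b, a} = {s, t}" using y(1) by auto
  ultimately show ?case by blast
qed

lemma cox_eq_ConsD: "s # u \<simeq> s # v \<Longrightarrow> u \<simeq> v"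
proof -
  assume a: "s # u \<simeq> s # v"
  then have l: "s \<in> S" "u \<in> lists S" "v \<in> lists S" using cox_eq_in_lists[OF a] by simp_all
  have "u \<simeq> [s, s] @ v" using cox_eq_left_iff[of "[s]" u "s # v"] a l by simp
  also have "[s, s] @ v \<simeq> v" using cox_eq_delete[OF cox_eq_square, of s "[]" v] l by simp
  finally show ?thesis .
qed

text \<open>Equal first letters are cancelled. For different first letters s and t,
  \<open>common_descents\<close> supplies two words that differ by one braid move, one sharing its
  first letter with \<open>u\<close> and the other with \<open>v\<close>.\<close>

theorem matsumoto: "red u \<Longrightarrow> red v \<Longrightarrow> u \<simeq> v \<Longrightarrow> braid u v"
proof (induction "length u" arbitrary: u v rule: less_induct)
  case less
  have len: "length u = length v"
    using less.prems unfolding red_iff by (meson cox_eq.sym le_antisym)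
  show ?case
  proof (cases u)
    case Nil
    then show ?thesis using len by (simp add: braid.refl)
  next
    case (Cons s u')
    then obtain t v' where v: "v = t # v'" using len by (cases v) auto
    have st: "s \<in> S" "t \<in> S" using red_in_lists[OF less.prems(1)] red_in_lists[OF less.prems(2)] Cons v by auto
    have same_head: "braid x y"
      if "x = r # x'" "y = r # y'" "length x = length u" "red x" "red y" "x \<simeq> y" for x y r x' y'
    proof -
      have "braid x' y'"
        using that less.hyps[of x' y'] cox_eq_ConsD[of r x' y'] red_ConsD by auto
      moreover have "r \<in> S" using red_in_lists[OF that(4)] that by simp
      ultimately show ?thesis using braid_context[of x' y' "[r]" "[]"] that by simp
    qed
    show ?thesis
    proof (cases "s = t")
      case True
      then show ?thesis using same_head[of u s u' v v'] less.prems Cons v by blast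
    next
      case False
      have p: "par u [s]" "par u [t]"
        using par_Cons_red[of s u'] par_Cons_red[of t v'] less.prems Cons v
          par_cox_eq[of u v "[t]"] st by auto
      show ?thesis
      proof (cases "m s t")
        case infinity
        \<comment> \<open>An alternating beginning longer than \<open>u\<close> would have to fit
          into a word of the length of \<open>u\<close>.\<close>
        then show ?thesis
          using common_descents[OF st False less.prems(1) p, of "Suc (length u)"] by auto
      next
        case (enat n)
        then obtain y a b where y: "{a, b} = {s, t}" "red (alt_word n a b @ y)"
          "alt_word n a b @ y \<simeq> u" "length (alt_word n a b @ y) = length u"
          using common_descents[OF st False less.prems(1) p, of n] by auto
        have "n \<ge> 2" using m_ge_2[of s t] st False enat by (simp add: numeral_eq_enat)
        then obtain k where k: "n = Suc k" by (cases n) auto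
        have nts: "m t s = enat n" using enat m_sym st by simp
        have yl: "y \<in> lists S" using red_in_lists[OF y(2)] by simp
        \<comment> \<open>Which of s and t starts the word from \<open>common_descents\<close> is
          unknown. The braid relation makes both versions available in either case.\<close>
        have swap: "alt_word n s t @ y \<simeq> alt_word n t s @ y"
          using cox_eq_braid[OF st enat] yl by (intro cox_eq_append cox_eq.refl)
        have 1: "alt_word n s t @ y \<simeq> u" "alt_word n t s @ y \<simeq> u"
          using y(1,3) swap by (auto simp: doubleton_eq_iff intro: cox_eq.trans cox_eq.sym)
        then have 2: "red (alt_word n s t @ y)" "red (alt_word n t s @ y)"
          using y(4) less.prems(1) by (auto intro: red_cox_eq)
        have "braid u (alt_word n s t @ y)"
          using 1 2 y(4) less.prems Cons k
          by (intro same_head[of u s u' _ "alt_word k t s @ y"]) (auto intro: cox_eq.sym)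
        then have "braid u ([] @ alt_word n s t @ y)" by simp
        then have "braid u ([] @ alt_word n t s @ y)" using st False enat by (rule braid.step)
        moreover have "braid (alt_word n t s @ y) v"
          using 1 2 y(4) less.prems v k
          by (intro same_head[of _ t "alt_word k s t @ y" v v']) (auto intro: cox_eq.trans)
        ultimately show ?thesis using braid_trans by simp
      qed
    qed
  qed
qed

text \<open>Consider the first letter s that destroys reducedness. The reduced word before it has a
  reduced form ending in s, reached by braid moves.\<close>

lemma not_red_braid_square:
  "v \<in> lists S \<Longrightarrow> \<not> red v \<Longrightarrow> \<exists>x s y. braid v (x @ [s, s] @ y)"
proof (induction v rule: rev_induct)
  case Nil
  then show ?case by (simp add: red_iff)
next
  case (snoc s v)
  show ?case
  proof (cases "red v")
    case True
    then obtain y where y: "red (y @ [s])" "y @ [s] \<simeq> v"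
      using red_snocE[of v s] snoc.prems by auto
    then have "braid v (y @ [s])" using matsumoto True cox_eq.sym by blast
    then have "braid (v @ [s]) (y @ [s, s] @ [])"
      using braid_context[of v "y @ [s]" "[]" "[s]"] snoc.prems by simp
    then show ?thesis by blast
  next
    case False
    then obtain x r y where "braid v (x @ [r, r] @ y)" using snoc by auto
    then have "braid (v @ [s]) (x @ [r, r] @ y @ [s])"
      using braid_context[of v "x @ [r, r] @ y" "[]" "[s]"] snoc.prems by simp
    then show ?thesis by blast
  qed
qed

end

section \<open>Groupoids\<close>

lemma is_inverse_edge_sym:
  "g \<in> edges G \<Longrightarrow> is_inverse_edge G g h \<Longrightarrow> is_inverse_edge G h g"
  by (simp add: is_inverse_edge_def)

context groupoid
begin

lemma inverse_unique:
  assumes "g \<in> edges G" "h \<in> edges G" "terminus G g = origin G h" "gcomp G g h = gid G (origin G g)"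
    and "is_inverse_edge G g k"
  shows "h = k"
proof -
  have k: "k \<in> edges G" "origin G k = terminus G g" "terminus G k = origin G g"
    "gcomp G k g = gid G (terminus G g)"
    using assms(5) by (auto simp: is_inverse_edge_def)
  have "h = gcomp G (gcomp G k g) h" using gid_gcomp[OF assms(2)] assms(3) k(4) by simp
  also have "\<dots> = gcomp G k (gid G (terminus G k))"
    using gcomp_assoc[of k g h] assms(1-4) k by simp
  also have "\<dots> = k" using gcomp_gid k(1) by blast
  finally show ?thesis .
qed

lemma ginv_eqI: "g \<in> edges G \<Longrightarrow> is_inverse_edge G g h \<Longrightarrow> ginv G g = h"
  unfolding ginv_def
  by (rule the_equality) (auto intro: inverse_unique simp: is_inverse_edge_def)

lemma is_inverse_ginv: "g \<in> edges G \<Longrightarrow> is_inverse_edge G g (ginv G g)"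
  using inverse_ex ginv_eqI by blast

lemma ginv_ginv: "g \<in> edges G \<Longrightarrow> ginv G (ginv G g) = g"
  using is_inverse_ginv is_inverse_edge_sym ginv_eqI is_inverse_edge_def by metis

text \<open>The vertex \<open>v\<close> is arbitrary because \<open>cs_edges\<close> excludes the
  identities at all chambers. The lemma shows that composing non-inverse edges yields an edge of the
  chamber system.\<close>

lemma gcomp_eq_gid:
  assumes "g \<in> edges G" "h \<in> edges G" "terminus G g = origin G h" "gcomp G g h = gid G v" "v \<in> verts G"
  shows "h = ginv G g"
proof -
  have "v = origin G g" using origin_gcomp[OF assms(1-3)] origin_gid[OF assms(5)] assms(4) by simp
  then show ?thesis using inverse_unique assms is_inverse_ginv by blast
qed

lemma ginv_eq_gid:
  assumes "g \<in> edges G" "ginv G g = gid G v" "v \<in> verts G"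
  shows "g = gid G v"
proof -
  have i: "is_inverse_edge G g (gid G v)" using is_inverse_ginv assms by metis
  then have "v = terminus G g" using origin_gid[OF assms(3)] by (simp add: is_inverse_edge_def)
  then have "g = gid G (origin G g)" using i gcomp_gid[OF assms(1)] by (simp add: is_inverse_edge_def)
  moreover have "origin G g = v" using i terminus_gid[OF assms(3)] by (simp add: is_inverse_edge_def)
  ultimately show ?thesis by simp
qed

end

section \<open>Galleries and homotopies\<close>

context weyl_data
begin

abbreviation path :: "'c \<Rightarrow> ('s \<times> 'e) list \<Rightarrow> 'c \<Rightarrow> bool" where
  "path \<equiv> is_path S \<W>"

abbreviation homot :: "'c \<Rightarrow> ('s \<times> 'e) list \<Rightarrow> ('s \<times> 'e) list \<Rightarrow> bool" where
  "homot c xs ys \<equiv> homotopic S m \<W> (c, xs) (c, ys)"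

abbreviation panel_inv :: "'s \<Rightarrow> 'e \<Rightarrow> 'e" where
  "panel_inv s \<equiv> ginv (panel_groupoid \<W> s)"

lemma cs_edgeD:
  assumes "(s, i) \<in> cs_edges S \<W>"
  shows "s \<in> S" "i \<in> edges (panel_groupoid \<W> s)"
    "origin (panel_groupoid \<W> s) i \<in> chambers \<W>" "terminus (panel_groupoid \<W> s) i \<in> chambers \<W>"
    "v \<in> chambers \<W> \<Longrightarrow> i \<noteq> gid (panel_groupoid \<W> s) v"
proof -
  show s: "s \<in> S" and i: "i \<in> edges (panel_groupoid \<W> s)" using assms by (auto simp: cs_edges_def)
  show "v \<in> chambers \<W> \<Longrightarrow> i \<noteq> gid (panel_groupoid \<W> s) v"
    using assms panel_verts[OF s] by (auto simp: cs_edges_def)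
  show "origin (panel_groupoid \<W> s) i \<in> chambers \<W>" "terminus (panel_groupoid \<W> s) i \<in> chambers \<W>"
    using groupoid.origin_in groupoid.terminus_in panel_groupoid[OF s] panel_verts[OF s] i by fast+
qed

lemma cs_edgeI:
  assumes "s \<in> S" "i \<in> edges (panel_groupoid \<W> s)"
    and "\<And>v. v \<in> chambers \<W> \<Longrightarrow> i \<noteq> gid (panel_groupoid \<W> s) v"
  shows "(s, i) \<in> cs_edges S \<W>"
  using assms panel_verts[OF assms(1)] by (auto simp: cs_edges_def)

lemma panel_inv_edge:
  assumes "(s, i) \<in> cs_edges S \<W>"
  shows "(s, panel_inv s i) \<in> cs_edges S \<W>"
    "origin (panel_groupoid \<W> s) (panel_inv s i) = terminus (panel_groupoid \<W> s) i"
    "terminus (panel_groupoid \<W> s) (panel_inv s i) = origin (panel_groupoid \<W> s) i"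
    "panel_inv s (panel_inv s i) = i"
proof -
  note e = cs_edgeD[OF assms]
  interpret P: groupoid "panel_groupoid \<W> s" using panel_groupoid e by blast
  have i: "is_inverse_edge (panel_groupoid \<W> s) i (panel_inv s i)" using P.is_inverse_ginv e by blast
  then show "origin (panel_groupoid \<W> s) (panel_inv s i) = terminus (panel_groupoid \<W> s) i"
    "terminus (panel_groupoid \<W> s) (panel_inv s i) = origin (panel_groupoid \<W> s) i"
    by (simp_all add: is_inverse_edge_def)
  show "panel_inv s (panel_inv s i) = i" using P.ginv_ginv e by blast
  show "(s, panel_inv s i) \<in> cs_edges S \<W>"
  proof (rule cs_edgeI)
    show "panel_inv s i \<in> edges (panel_groupoid \<W> s)" using i by (simp add: is_inverse_edge_def)
    show "panel_inv s i \<noteq> gid (panel_groupoid \<W> s) v" if "v \<in> chambers \<W>" for v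
      using P.ginv_eq_gid[of i v] e(2) e(5)[of v] that panel_verts[OF e(1)] by auto
  qed (fact e)
qed

lemma panel_comp_edge:
  assumes "(s, i) \<in> cs_edges S \<W>" "(s, j) \<in> cs_edges S \<W>"
    "origin (panel_groupoid \<W> s) j = terminus (panel_groupoid \<W> s) i" "j \<noteq> panel_inv s i"
  shows "(s, gcomp (panel_groupoid \<W> s) i j) \<in> cs_edges S \<W>"
    "origin (panel_groupoid \<W> s) (gcomp (panel_groupoid \<W> s) i j) = origin (panel_groupoid \<W> s) i"
    "terminus (panel_groupoid \<W> s) (gcomp (panel_groupoid \<W> s) i j) = terminus (panel_groupoid \<W> s) j"
proof -
  note e = cs_edgeD[OF assms(1)] and f = cs_edgeD[OF assms(2)]
  interpret P: groupoid "panel_groupoid \<W> s" using panel_groupoid e by blast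
  show "origin (panel_groupoid \<W> s) (gcomp (panel_groupoid \<W> s) i j) = origin (panel_groupoid \<W> s) i"
    "terminus (panel_groupoid \<W> s) (gcomp (panel_groupoid \<W> s) i j) = terminus (panel_groupoid \<W> s) j"
    using P.origin_gcomp P.terminus_gcomp e f assms(3) by auto
  show "(s, gcomp (panel_groupoid \<W> s) i j) \<in> cs_edges S \<W>"
  proof (rule cs_edgeI)
    show "gcomp (panel_groupoid \<W> s) i j \<in> edges (panel_groupoid \<W> s)"
      using P.gcomp_in e f assms(3) by auto
    show "gcomp (panel_groupoid \<W> s) i j \<noteq> gid (panel_groupoid \<W> s) v" if "v \<in> chambers \<W>" for v
      using P.gcomp_eq_gid[of i j v] e(2) f(2) assms(3,4) that panel_verts[OF e(1)] by auto
  qed (fact e)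
qed

lemma path_chambers: "path c es d \<Longrightarrow> c \<in> chambers \<W> \<and> d \<in> chambers \<W>"
proof (induction es arbitrary: c)
  case (Cons e es)
  obtain s i where "e = (s, i)" by (cases e)
  then show ?case using Cons cs_edgeD(3)[of s i] by auto
qed simp

lemma path_append: "path c (xs @ ys) e \<longleftrightarrow> (\<exists>d. path c xs d \<and> path d ys e)"
proof (induction xs arbitrary: c)
  case Nil
  then show ?case using path_chambers by auto
next
  case (Cons a xs)
  then show ?case by (cases a) auto
qed

lemma path_unique: "path c es d \<Longrightarrow> path c es d' \<Longrightarrow> d = d'"
proof (induction es arbitrary: c)
  case (Cons a es)
  then show ?case by (cases a) auto
qed simp

lemma path_single:
  "path c [(s, i)] d \<longleftrightarrow> (s, i) \<in> cs_edges S \<W> \<and> origin (panel_groupoid \<W> s) i = c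
    \<and> terminus (panel_groupoid \<W> s) i = d"
  using cs_edgeD(4)[of s i] by auto

lemma gal_term_eq: "path c es d \<Longrightarrow> gal_term \<W> (c, es) = d"
proof (induction es arbitrary: c)
  case Nil
  then show ?case by (simp add: gal_term_def)
next
  case (Cons a es)
  obtain s i where a: "a = (s, i)" by (cases a)
  have "gal_term \<W> (terminus (panel_groupoid \<W> s) i, es) = d" using Cons a by simp
  then show ?case using a by (cases es) (simp_all add: gal_term_def)
qed

lemma path_types: "path c es d \<Longrightarrow> map fst es \<in> lists S"
proof (induction es arbitrary: c)
  case (Cons a es)
  obtain s i where "a = (s, i)" by (cases a)
  then show ?case using Cons cs_edgeD(1)[of s i] by auto
qed simp

lemma gallery_iff: "gallery S \<W> (c, es) \<longleftrightarrow> (\<exists>d. path c es d)"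
  by (simp add: gallery_def)

text \<open>The rules require only the left side to be a gallery. The right side is one with the
  same ends because inverse edges and suites return to their starting chamber and composition keeps
  the outer ends.\<close>

lemma elem_homotopy_path:
  assumes "elem_homotopy S m \<W> \<beta> \<gamma>"
  shows "\<exists>c xs ys d. \<beta> = (c, xs) \<and> \<gamma> = (c, ys) \<and> path c xs d \<and> path c ys d"
  using assms
proof cases
  case (delete_inverse c xs s i i' ys)
  then obtain d where "path c (xs @ [(s, i), (s, i')] @ ys) d" by (auto simp: gallery_iff)
  moreover from this obtain p where "path c xs p" "path p ((s, i) # (s, i') # ys) d"
    by (auto simp: path_append)
  moreover from this have "path c (xs @ ys) d"
    using panel_inv_edge(3)[of s i] delete_inverse by (auto simp: path_append)
  ultimately show ?thesis using delete_inverse by blast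
next
  case (compose_edges c xs s i i' ys)
  then obtain d where "path c (xs @ [(s, i), (s, i')] @ ys) d" by (auto simp: gallery_iff)
  moreover from this obtain p where "path c xs p" "path p ((s, i) # (s, i') # ys) d"
    by (auto simp: path_append)
  moreover from this have "path c (xs @ [(s, gcomp (panel_groupoid \<W> s) i i')] @ ys) d"
    using panel_comp_edge[of s i i'] compose_edges by (auto simp: path_append)
  ultimately show ?thesis using compose_edges by blast
next
  case (delete_suite c xs \<omega> ys)
  then obtain d where d: "path c (xs @ snd \<omega> @ ys) d" by (auto simp: gallery_iff)
  then obtain p q where pq: "path c xs p" "path p (snd \<omega>) q" "path q ys d"
    by (auto simp: path_append)
  obtain s t where "st_cycle S m \<W> s t \<omega>"
    using delete_suite(5) suites_cycles unfolding defining_suites_def by blast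
  then have "gal_term \<W> (fst \<omega>, snd \<omega>) = fst \<omega>" by (simp add: st_cycle_def gal_init_def)
  moreover have "fst \<omega> = p" using delete_suite(4) gal_term_eq[OF pq(1)] by (simp add: gal_init_def)
  ultimately have "q = p" using gal_term_eq[OF pq(2)] by simp
  then show ?thesis using delete_suite d pq by (auto simp: path_append)
qed

lemma homotopic_refl [simp]: "homotopic S m \<W> \<beta> \<beta>"
  by (simp add: homotopic_def)

lemma homotopic_sym: "homotopic S m \<W> \<beta> \<gamma> \<Longrightarrow> homotopic S m \<W> \<gamma> \<beta>"
  unfolding homotopic_def by (rule equivclp_sym)

lemma homotopic_trans [trans]:
  "homotopic S m \<W> \<alpha> \<beta> \<Longrightarrow> homotopic S m \<W> \<beta> \<gamma> \<Longrightarrow> homotopic S m \<W> \<alpha> \<gamma>"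
  unfolding homotopic_def by (rule equivclp_trans)

lemma elem_homotopy_homotopic: "elem_homotopy S m \<W> \<beta> \<gamma> \<Longrightarrow> homotopic S m \<W> \<beta> \<gamma>"
  unfolding homotopic_def by auto

text \<open>An intermediate gallery may be either side of a move, and \<open>path_unique\<close>
  matches the end chamber of the move with \<open>d\<close>.\<close>

lemma homotopic_path:
  assumes "homotopic S m \<W> (c, es) \<gamma>" "path c es d"
  shows "fst \<gamma> = c \<and> path c (snd \<gamma>) d"
  using assms(1) unfolding homotopic_def
proof (induction rule: equivclp_induct)
  case base
  then show ?case using assms by simp
next
  case (step \<beta> \<gamma>)
  then obtain p xs ys q where "\<beta> = (p, xs) \<and> \<gamma> = (p, ys) \<or> \<beta> = (p, ys) \<and> \<gamma> = (p, xs)"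
    "path p xs q" "path p ys q"
    using elem_homotopy_path by blast
  then show ?case using step.IH path_unique by (metis fst_conv snd_conv)
qed

lemma elem_homotopy_context:
  assumes "elem_homotopy S m \<W> (d, a) (d', b)" "path c xs d" "path d a e" "path e ys f"
  shows "elem_homotopy S m \<W> (c, xs @ a @ ys) (c, xs @ b @ ys)"
proof -
  have gal: "gallery S \<W> (c, xs @ a @ ys)" using assms by (auto simp: gallery_iff path_append)
  from assms(1) show ?thesis
  proof cases
    case (delete_inverse as s i i' bs)
    then show ?thesis
      using elem_homotopy.delete_inverse[of S \<W> c "xs @ as" s i i' "bs @ ys" m] gal by simp
  next
    case (compose_edges as s i i' bs)
    then show ?thesis
      using elem_homotopy.compose_edges[of S \<W> c "xs @ as" s i i' "bs @ ys" m] gal by simp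
  next
    case (delete_suite as \<omega> bs)
    obtain p where p: "path d as p" using assms(3) delete_suite(1) by (auto simp: path_append)
    then have "path c (xs @ as) p" using assms(2) by (auto simp: path_append)
    then have "gal_term \<W> (c, xs @ as) = gal_init \<omega>"
      using gal_term_eq[OF p] gal_term_eq delete_suite by metis
    then show ?thesis
      using elem_homotopy.delete_suite[of S \<W> c "xs @ as" \<omega> "bs @ ys" m] gal delete_suite by simp
  qed
qed

text \<open>A context fits only around galleries from \<open>d\<close> to \<open>e\<close>, so the
  induction follows the chain from \<open>(d, a)\<close> and checks the ends at every link.\<close>

lemma homotopic_context:
  assumes "homot d a b" "path c xs d" "path d a e" "path e ys f"
  shows "homot c (xs @ a @ ys) (xs @ b @ ys)"
proof -
  have "homot c (xs @ a @ ys) (xs @ snd \<gamma> @ ys)" if "homotopic S m \<W> (d, a) \<gamma>" for \<gamma>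
    using that unfolding homotopic_def
  proof (induction rule: equivclp_induct)
    case (step \<beta> \<gamma>)
    have \<beta>: "fst \<beta> = d" "path d (snd \<beta>) e"
      using homotopic_path[of d a \<beta> e] step.hyps(1) assms(3) by (simp_all add: homotopic_def)
    have "homotopic S m \<W> (d, a) \<gamma>"
      unfolding homotopic_def using step.hyps by (meson equivclp_into_equivclp)
    then have \<gamma>: "fst \<gamma> = d" "path d (snd \<gamma>) e"
      using homotopic_path[of d a \<gamma> e] assms(3) by simp_all
    have "homot c (xs @ snd \<beta> @ ys) (xs @ snd \<gamma> @ ys)"
      using step.hyps(2)
    proof
      assume "elem_homotopy S m \<W> \<beta> \<gamma>"
      then have "elem_homotopy S m \<W> (d, snd \<beta>) (d, snd \<gamma>)" using \<beta>(1) \<gamma>(1) by (metis prod.collapse)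
      then show ?thesis
        using elem_homotopy_context assms \<beta> elem_homotopy_homotopic by blast
    next
      assume "elem_homotopy S m \<W> \<gamma> \<beta>"
      then have "elem_homotopy S m \<W> (d, snd \<gamma>) (d, snd \<beta>)" using \<beta>(1) \<gamma>(1) by (metis prod.collapse)
      then show ?thesis
        using elem_homotopy_context assms \<gamma> elem_homotopy_homotopic homotopic_sym by blast
    qed
    then show ?case using step.IH equivclp_trans unfolding homotopic_def by metis
  qed simp
  from this[OF assms(1)] show ?thesis by simp
qed

lemma homotopic_append:
  assumes "homot c xs xs'" "homot d ys ys'" "path c xs d" "path d ys e"
  shows "homot c (xs @ ys) (xs' @ ys')"
proof -
  have "path c [] c" "path e [] e" using path_chambers assms by auto
  moreover have "path c xs' d" using homotopic_path[OF assms(1,3)] by simp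
  ultimately have "homot c ([] @ xs @ ys) ([] @ xs' @ ys)" "homot c (xs' @ ys @ []) (xs' @ ys' @ [])"
    using homotopic_context assms by blast+
  then show ?thesis using homotopic_trans by simp
qed

section \<open>Inverse galleries\<close>

definition inv_path :: "('s \<times> 'e) list \<Rightarrow> ('s \<times> 'e) list" where
  "inv_path es = rev (map (\<lambda>(s, i). (s, panel_inv s i)) es)"

lemma path_inv_path: "path c es d \<Longrightarrow> path d (inv_path es) c"
proof (induction es arbitrary: c)
  case (Cons a es)
  obtain s i where a: "a = (s, i)" by (cases a)
  have "path (terminus (panel_groupoid \<W> s) i) [(s, panel_inv s i)] c"
    unfolding path_single using Cons.prems a panel_inv_edge[of s i] by auto
  then show ?case using Cons a by (auto simp: inv_path_def path_append)
qed (simp add: inv_path_def)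

lemma inv_path_inv_path: "path c es d \<Longrightarrow> inv_path (inv_path es) = es"
proof (induction es arbitrary: c)
  case (Cons a es)
  obtain s i where a: "a = (s, i)" by (cases a)
  then show ?case using Cons panel_inv_edge(4)[of s i] by (auto simp: inv_path_def rev_map)
qed (simp add: inv_path_def)

lemma homotopic_inv_path: "path c es d \<Longrightarrow> homot c (es @ inv_path es) []"
proof (induction es arbitrary: c)
  case (Cons a es)
  obtain s i where a: "a = (s, i)" by (cases a)
  define p where "p = terminus (panel_groupoid \<W> s) i"
  have e: "(s, i) \<in> cs_edges S \<W>" "origin (panel_groupoid \<W> s) i = c" and p: "path p es d"
    using Cons.prems a by (auto simp: p_def)
  have i: "path c [(s, i)] p" "path p [(s, panel_inv s i)] c"
    unfolding path_single using panel_inv_edge[OF e(1)] e by (auto simp: p_def)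
  have "homot c ([(s, i)] @ (es @ inv_path es) @ [(s, panel_inv s i)])
      ([(s, i)] @ [] @ [(s, panel_inv s i)])"
    using p path_inv_path[OF p] i Cons.IH[OF p]
    by (intro homotopic_context[of p _ _ c _ p _ c]) (auto simp: path_append)
  also have "gallery S \<W> (c, [] @ [(s, i), (s, panel_inv s i)] @ [])"
    using i path_append[of c "[(s, i)]" "[(s, panel_inv s i)]" c] by (auto simp: gallery_iff)
  then have "homot c ([(s, i)] @ [] @ [(s, panel_inv s i)]) []"
    using elem_homotopy.delete_inverse[of S \<W> c "[]" s i "panel_inv s i" "[]" m]
      elem_homotopy_homotopic by simp
  finally show ?case using a by (simp add: inv_path_def)
qed (simp add: inv_path_def)

section \<open>The fundamental groupoid\<close>

abbreviation cls :: "'c \<Rightarrow> ('s \<times> 'e) list \<Rightarrow> ('s, 'c, 'e) gallery set" where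
  "cls c es \<equiv> homotopy_class S m \<W> (c, es)"

abbreviation FG where "FG \<equiv> fundamental_groupoid S m \<W>"

lemma FG_simps [simp]:
  "verts FG = chambers \<W>" "gid FG c = cls c []"
  by (simp_all add: fundamental_groupoid_def)

lemma cls_memD:
  assumes "\<beta> \<in> cls c es" "path c es d"
  obtains xs where "\<beta> = (c, xs)" "path c xs d" "homot c es xs"
  using assms homotopic_path[of c es \<beta> d] by (cases \<beta>) (auto simp: homotopy_class_def)

lemma cls_mem: "path c es d \<Longrightarrow> homot c es xs \<Longrightarrow> (c, xs) \<in> cls c es"
  using homotopic_path[of c es "(c, xs)" d] by (auto simp: homotopy_class_def gallery_iff)

lemma cls_eqI: "homot c es xs \<Longrightarrow> cls c es = cls c xs"
  unfolding homotopy_class_def by (blast intro: homotopic_trans homotopic_sym)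

lemma FG_edge_iff: "X \<in> edges FG \<longleftrightarrow> (\<exists>c es d. path c es d \<and> X = cls c es)"
proof -
  have "X \<in> edges FG \<longleftrightarrow> (\<exists>\<beta>. gallery S \<W> \<beta> \<and> X = homotopy_class S m \<W> \<beta>)"
    by (auto simp: fundamental_groupoid_def)
  then show ?thesis by (simp add: gallery_iff)
qed

lemma FG_origin: assumes "path c es d" shows "origin FG (cls c es) = c"
proof -
  have "(THE v. \<exists>\<beta>\<in>cls c es. gal_init \<beta> = v) = c"
  proof (rule the_equality)
    show "\<exists>\<beta>\<in>cls c es. gal_init \<beta> = c"
      using cls_mem[OF assms homotopic_refl] by (force simp: gal_init_def)
    show "v = c" if "\<exists>\<beta>\<in>cls c es. gal_init \<beta> = v" for v
      using that assms by (auto simp: gal_init_def elim: cls_memD)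
  qed
  then show ?thesis by (simp add: fundamental_groupoid_def)
qed

lemma FG_terminus: assumes "path c es d" shows "terminus FG (cls c es) = d"
proof -
  have "(THE v. \<exists>\<beta>\<in>cls c es. gal_term \<W> \<beta> = v) = d"
  proof (rule the_equality)
    show "\<exists>\<beta>\<in>cls c es. gal_term \<W> \<beta> = d"
      using cls_mem[OF assms homotopic_refl] gal_term_eq[OF assms] by force
    show "v = d" if "\<exists>\<beta>\<in>cls c es. gal_term \<W> \<beta> = v" for v
      using that assms gal_term_eq by (auto elim!: cls_memD)
  qed
  then show ?thesis by (simp add: fundamental_groupoid_def)
qed

text \<open>All concatenations of representatives are homotopic, so the union in
  \<open>gcomp\<close> runs over copies of one class.\<close>

lemma FG_gcomp:
  assumes "path c es d" "path d fs e"
  shows "gcomp FG (cls c es) (cls d fs) = cls c (es @ fs)"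
proof -
  have "homotopy_class S m \<W> (gal_concat \<beta> \<gamma>) = cls c (es @ fs)"
    if mem: "\<beta> \<in> cls c es" "\<gamma> \<in> cls d fs" for \<beta> \<gamma>
  proof -
    obtain xs where xs: "\<beta> = (c, xs)" "homot c es xs" using cls_memD[OF mem(1) assms(1)] by blast
    obtain ys where ys: "\<gamma> = (d, ys)" "homot d fs ys" using cls_memD[OF mem(2) assms(2)] by blast
    show ?thesis
      using cls_eqI[OF homotopic_append[OF xs(2) ys(2) assms]] xs ys by (simp add: gal_concat_def)
  qed
  moreover have "(c, es) \<in> cls c es" "(d, fs) \<in> cls d fs" using cls_mem assms by auto
  ultimately have "(\<Union>\<beta>\<in>cls c es. \<Union>\<gamma>\<in>cls d fs. homotopy_class S m \<W> (gal_concat \<beta> \<gamma>)) = cls c (es @ fs)"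
    by blast
  then show ?thesis by (simp add: fundamental_groupoid_def)
qed

lemma FG_inverse:
  assumes "path c es d"
  shows "is_inverse_edge FG (cls c es) (cls d (inv_path es))"
proof -
  note inv = path_inv_path[OF assms]
  have "homot d (inv_path es @ es) []"
    using homotopic_inv_path[OF inv] inv_path_inv_path[OF assms] by simp
  then show ?thesis
    unfolding is_inverse_edge_def
    using cls_eqI homotopic_inv_path[OF assms] assms inv FG_edge_iff
    by (auto simp: FG_origin FG_terminus FG_gcomp)
qed

lemma groupoid_FG: "groupoid FG"
proof
  show "verts FG \<noteq> {}" using chambers_nonempty by simp
next
  fix g assume "g \<in> edges FG"
  then obtain c es d where g: "g = cls c es" "path c es d" unfolding FG_edge_iff by blast
  note v = path_chambers[OF g(2)]
  then have triv: "path c [] c" "path d [] d" by auto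
  show "origin FG g \<in> verts FG" "terminus FG g \<in> verts FG"
    using g v by (simp_all add: FG_origin FG_terminus)
  show "gcomp FG (gid FG (origin FG g)) g = g" "gcomp FG g (gid FG (terminus FG g)) = g"
    using g FG_gcomp[OF triv(1) g(2)] FG_gcomp[OF g(2) triv(2)] by (simp_all add: FG_origin FG_terminus)
  show "\<exists>h. is_inverse_edge FG g h" using FG_inverse g by blast
next
  fix v assume "v \<in> verts FG"
  then have v: "path v [] v" by simp
  then show "gid FG v \<in> edges FG" unfolding FG_edge_iff FG_simps by blast
  show "origin FG (gid FG v) = v" "terminus FG (gid FG v) = v"
    using v by (simp_all add: FG_origin FG_terminus)
next
  fix g h assume "g \<in> edges FG" "h \<in> edges FG" "terminus FG g = origin FG h"
  then obtain c es d fs e where g: "g = cls c es" "path c es d" and h: "h = cls d fs" "path d fs e"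
    unfolding FG_edge_iff by (auto simp: FG_origin FG_terminus)
  then have gh: "gcomp FG g h = cls c (es @ fs)" "path c (es @ fs) e"
    by (auto simp: FG_gcomp path_append)
  then show "gcomp FG g h \<in> edges FG" unfolding FG_edge_iff by blast
  show "origin FG (gcomp FG g h) = origin FG g" "terminus FG (gcomp FG g h) = terminus FG h"
    unfolding gh using g h gh(2) by (simp_all add: FG_origin FG_terminus)
  fix k assume "k \<in> edges FG" "terminus FG h = origin FG k"
  then obtain gs f where k: "k = cls e gs" "path e gs f"
    using h unfolding FG_edge_iff by (auto simp: FG_origin FG_terminus)
  have "path d (fs @ gs) f" using h k by (auto simp: path_append)
  then show "gcomp FG (gcomp FG g h) k = gcomp FG g (gcomp FG h k)"
    using g h k gh by (simp add: FG_gcomp)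
qed

end

section \<open>Geodesics\<close>

context pre_weyl_graph
begin

text \<open>The gallery supplied by (PW1) has the same end chambers as the one it replaces, so it
  fits between the unchanged parts.\<close>

lemma braid_lift:
  "braid u v \<Longrightarrow> path c es d \<Longrightarrow> map fst es = u \<Longrightarrow> \<exists>fs. path c fs d \<and> map fst fs = v \<and> homot c es fs"
proof (induction rule: braid.induct)
  case (refl u)
  then show ?case using homotopic_refl by blast
next
  case (step u xs n s t ys)
  then obtain fs where fs: "path c fs d" "map fst fs = xs @ alt_word n s t @ ys" "homot c es fs"
    by blast
  then obtain as bs cs where split: "fs = as @ bs @ cs"
    "map fst as = xs" "map fst bs = alt_word n s t" "map fst cs = ys"
    by (auto simp: map_eq_append_conv append_eq_map_conv)
  obtain p q where pq: "path c as p" "path p bs q" "path q cs d"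
    using fs(1) split(1) by (auto simp: path_append)
  have "max_geodesic S m \<W> s t (p, bs)"
    using pq(2) split(3) step by (auto simp: max_geodesic_def gal_type_def gallery_iff)
  then obtain \<gamma> where \<gamma>: "max_geodesic S m \<W> t s \<gamma>" "homotopic S m \<W> (p, bs) \<gamma>"
    using PW1[of s t "(p, bs)"] step by auto
  obtain bs' where bs': "\<gamma> = (p, bs')" "path p bs' q"
    using homotopic_path[OF \<gamma>(2) pq(2)] by (cases \<gamma>) auto
  have "map fst bs' = alt_word n t s"
    using \<gamma>(1) bs' step m_sym[of s t] by (auto simp: max_geodesic_def gal_type_def)
  moreover have "homot c (as @ bs @ cs) (as @ bs' @ cs)"
    using homotopic_context \<gamma>(2) bs' pq by blast
  moreover have "path c (as @ bs' @ cs) d" using pq bs' by (auto simp: path_append)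
  ultimately show ?case
    using fs(3) split homotopic_trans by (intro exI[of _ "as @ bs' @ cs"]) auto
qed

text \<open>Braid moves keep the length. Two consecutive edges of one type then either cancel or
  compose, and both shorten the gallery.\<close>

lemma homotopic_geodesic:
  "path c es d \<Longrightarrow> \<exists>fs. path c fs d \<and> red (map fst fs) \<and> homot c es fs"
proof (induction "length es" arbitrary: es rule: less_induct)
  case less
  show ?case
  proof (cases "red (map fst es)")
    case True
    then show ?thesis using less.prems homotopic_refl by blast
  next
    case False
    then obtain x s y where "braid (map fst es) (x @ [s, s] @ y)"
      using not_red_braid_square path_types[OF less.prems] by blast
    then obtain fs where fs: "path c fs d" "map fst fs = x @ [s, s] @ y" "homot c es fs"
      "length fs = length es"
      using braid_lift[OF _ less.prems] length_braid by (metis length_map)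
    then obtain as i j cs where split: "fs = as @ [(s, i), (s, j)] @ cs"
      by (auto simp: map_eq_append_conv Cons_eq_map_conv)
    have gal: "gallery S \<W> (c, as @ [(s, i), (s, j)] @ cs)" using fs(1) split gallery_iff by blast
    obtain gs where gs: "elem_homotopy S m \<W> (c, fs) (c, gs)" "length gs < length fs"
    proof (cases "j = panel_inv s i")
      case True
      then show thesis using elem_homotopy.delete_inverse[OF gal] split that by force
    next
      case False
      then show thesis using elem_homotopy.compose_edges[OF gal] split that by force
    qed
    have "path c gs d"
      using homotopic_path[OF elem_homotopy_homotopic[OF gs(1)] fs(1)] by simp
    then obtain hs where "path c hs d" "red (map fst hs)" "homot c gs hs"
      using less.hyps gs(2) fs(4) by metis
    moreover have "homot c es gs"
      using fs(3) elem_homotopy_homotopic[OF gs(1)] by (rule homotopic_trans)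
    ultimately show ?thesis using homotopic_trans by blast
  qed
qed

text \<open>If the identity were the only edge of type s at \<open>c\<close>, the s-panel of
  \<open>c\<close> would be a trivial groupoid, against (PW0).\<close>

lemma ex_edge:
  assumes "c \<in> chambers \<W>" "s \<in> S"
  shows "\<exists>i d. path c [(s, i)] d"
proof (rule ccontr)
  assume none: "\<not> ?thesis"
  let ?G = "panel_groupoid \<W> s"
  interpret P: groupoid ?G using panel_groupoid assms by blast
  have v: "verts ?G = chambers \<W>" using panel_verts assms by blast
  have only: "e = gid ?G c" if e: "e \<in> edges ?G" "origin ?G e = c" for e
  proof (rule ccontr)
    assume "e \<noteq> gid ?G c"
    then have "(s, e) \<in> cs_edges S \<W>"
      using e assms v P.origin_gid by (auto simp: cs_edges_def)
    then show False using none e unfolding path_single by blast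
  qed
  define U where "U = {u. \<exists>e \<in> edges ?G. origin ?G e = c \<and> terminus ?G e = u}"
  define P where "P = ?G\<lparr>verts := U, edges := {e \<in> edges ?G. origin ?G e \<in> U \<and> terminus ?G e \<in> U}\<rparr>"
  have id: "gid ?G c \<in> edges ?G" "origin ?G (gid ?G c) = c" "terminus ?G (gid ?G c) = c"
    using P.gid_in P.origin_gid P.terminus_gid assms v by auto
  have U: "U = {c}"
  proof (intro equalityI subsetI)
    fix u assume "u \<in> U"
    then obtain e where "e \<in> edges ?G" "origin ?G e = c" "terminus ?G e = u"
      by (auto simp: U_def)
    then show "u \<in> {c}" using only[of e] id(3) by simp
  next
    fix u assume "u \<in> {c}"
    then show "u \<in> U" using id by (auto simp: U_def)
  qed
  have "edges P = {gid ?G c}"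
  proof (intro equalityI subsetI)
    fix e assume "e \<in> edges P"
    then show "e \<in> {gid ?G c}" using only[of e] by (simp add: P_def U)
  next
    fix e assume "e \<in> {gid ?G c}"
    then show "e \<in> edges P" using id by (simp add: P_def U)
  qed
  moreover have "verts P = {c}" by (simp add: P_def U)
  ultimately have "trivial_groupoid P" by (auto simp: trivial_groupoid_def)
  moreover have "P \<in> connected_components ?G"
    using assms v by (auto simp: connected_components_def P_def U_def Let_def)
  ultimately show False using PW0 assms by blast
qed

end

section \<open>The metrization of a Weyl graph\<close>

context weyl_graph
begin

lemma red_single: "s \<in> S \<Longrightarrow> red [s]"
  using red_snoc_iff[of "[]" s] by (simp add: red_iff)

text \<open>This is where (W) enters.\<close>

lemma geodesics_cox_eq:
  assumes "path c es d" "red (map fst es)" "path c fs d" "red (map fst fs)" "homot c es fs"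
  shows "map fst es \<simeq> map fst fs"
proof -
  have "W_length S m (c, es) = W_length S m (c, fs)"
    using assms by (intro W) (auto simp: geodesic_def gal_type_def gallery_iff)
  then show ?thesis
    using word_elt_eq_iff path_types assms by (simp add: W_length_def gal_type_def)
qed

lemma metrization_cls:
  assumes "path c es d" "red (map fst es)"
  shows "metrization S m \<W> (cls c es) = word_elt S m (map fst es)"
  unfolding metrization_def
proof (rule the_equality)
  show "\<exists>\<gamma>\<in>cls c es. geodesic S m \<W> \<gamma> \<and> W_length S m \<gamma> = word_elt S m (map fst es)"
    using assms cls_mem[OF assms(1) homotopic_refl]
    by (intro bexI[of _ "(c, es)"]) (auto simp: geodesic_def W_length_def gal_type_def gallery_iff)
  fix w assume "\<exists>\<gamma>\<in>cls c es. geodesic S m \<W> \<gamma> \<and> W_length S m \<gamma> = w"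
  then obtain \<gamma> where \<gamma>: "\<gamma> \<in> cls c es" "geodesic S m \<W> \<gamma>" "W_length S m \<gamma> = w" by blast
  obtain fs where fs: "\<gamma> = (c, fs)" "path c fs d" "homot c es fs" using cls_memD[OF \<gamma>(1) assms(1)] .
  have "map fst es \<simeq> map fst fs"
    using geodesics_cox_eq[OF assms fs(2) _ fs(3)] \<gamma>(2) fs(1) by (simp add: geodesic_def gal_type_def)
  then show "w = word_elt S m (map fst es)"
    using \<gamma>(3) fs(1) word_elt_eq_iff[OF path_types[OF assms(1)] path_types[OF fs(2)]]
    by (simp add: W_length_def gal_type_def)
qed

lemma FG_edgeE:
  assumes "X \<in> edges FG"
  obtains c es d where "path c es d" "red (map fst es)" "X = cls c es"
proof -
  obtain c es d where es: "path c es d" "X = cls c es" using assms unfolding FG_edge_iff by blast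
  obtain fs where "path c fs d" "red (map fst fs)" "homot c es fs"
    using homotopic_geodesic[OF es(1)] by blast
  then show thesis using that es(2) cls_eqI by metis
qed

text \<open>The geodesic \<open>gs\<close> stays fixed and \<open>es\<close> varies in the induction
  over \<open>fs\<close>. Both parts remain geodesics, and at the end (W) lets \<open>us\<close> be
  the whole type of \<open>gs\<close>. Only an absorption removes a letter.\<close>

lemma concat_geodesics_subword:
  assumes "path c gs e" "red (map fst gs)"
  shows "path c es d \<Longrightarrow> path d fs e \<Longrightarrow> red (map fst es) \<Longrightarrow> red (map fst fs)
    \<Longrightarrow> homot c (es @ fs) gs
    \<Longrightarrow> \<exists>us. subseq us (map fst gs) \<and> us \<simeq> map fst es @ map fst fs"
proof (induction fs arbitrary: es d)
  case Nil
  then have "map fst es \<simeq> map fst gs" using geodesics_cox_eq assms by auto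
  then show ?case by (intro exI[of _ "map fst gs"]) (auto intro: cox_eq.sym)
next
  case (Cons a fs)
  obtain s i where a: "a = (s, i)" by (cases a)
  define p where "p = terminus (panel_groupoid \<W> s) i"
  let ?x = "map fst es" and ?y = "map fst fs"
  have i: "path d [(s, i)] p" and p: "path p fs e"
    using Cons.prems(2) a cs_edgeD(4)[of s i] by (auto simp: p_def)
  have s: "s \<in> S" using path_types[OF i] by simp
  have xy: "?x \<in> lists S" "?y \<in> lists S" using path_types Cons.prems(1) p by blast+
  have sy: "red (s # ?y)" "red ?y" using Cons.prems(4) a red_ConsD by auto
  show ?case
  proof (cases "red (?x @ [s])")
    case True
    have "path c (es @ [(s, i)]) p" using Cons.prems(1) i path_append by blast
    then show ?thesis using Cons.IH[of "es @ [(s, i)]" p] p True sy Cons.prems(5) a by simp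
  next
    case False
    then obtain z where z: "red (z @ [s])" "z @ [s] \<simeq> ?x"
      using red_snocE[OF Cons.prems(3) s] by blast
    then have zl: "z \<in> lists S" using red_in_lists by fastforce
    have rz: "red z" using red_infix[of "[]" z "[s]"] z(1) by simp
    \<comment> \<open>With x = zs, the wanted product xsy equals zy, whether the new edge cancels or
      is absorbed.\<close>
    have zy: "z @ ?y \<simeq> ?x @ s # ?y"
    proof -
      have "z @ ?y \<simeq> z @ [s, s] @ ?y"
        using zl xy s by (intro cox_eq.sym[OF cox_eq_delete] cox_eq_square)
      also have "z @ [s, s] @ ?y \<simeq> ?x @ s # ?y"
        using cox_eq_append[OF z(2) cox_eq.refl[of "s # ?y"]] xy s by simp
      finally show ?thesis by simp
    qed
    have "braid ?x (z @ [s])" using matsumoto Cons.prems(3) z cox_eq.sym by blast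
    then obtain es' where es': "path c es' d" "map fst es' = z @ [s]" "homot c es es'"
      using braid_lift Cons.prems(1) by blast
    then obtain as j where split: "es' = as @ [(s, j)]" "map fst as = z"
      by (auto simp: map_eq_append_conv Cons_eq_map_conv)
    obtain q where q: "path c as q" "path q [(s, j)] d" using es'(1) split path_append by blast
    have "homot c (es @ a # fs) (es' @ a # fs)"
      using homotopic_append es'(3) Cons.prems(1,2) homotopic_refl by blast
    then have h: "homot c (as @ (s, j) # (s, i) # fs) gs"
      using Cons.prems(5) split a homotopic_sym homotopic_trans by (metis append.assoc append_Cons append_Nil)
    have gal: "gallery S \<W> (c, as @ [(s, j), (s, i)] @ fs)"
      using q i p path_chambers[OF p] unfolding gallery_iff path_append path_single by auto
    show ?thesis
    proof (cases "i = panel_inv s j")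
      case True
      have el: "elem_homotopy S m \<W> (c, as @ [(s, j), (s, i)] @ fs) (c, as @ fs)"
        using elem_homotopy.delete_inverse[OF gal True] .
      have "homot c (as @ fs) gs"
        using homotopic_trans[OF homotopic_sym[OF elem_homotopy_homotopic[OF el]]] h by simp
      \<comment> \<open>The edge i leads back to the start of j, so \<open>fs\<close> begins where
        \<open>as\<close> ends.\<close>
      moreover have "q = p" using q i True panel_inv_edge[of s j] unfolding path_single by auto
      ultimately obtain us where "subseq us (map fst gs)" "us \<simeq> z @ ?y"
        using Cons.IH[of as q] q p sy rz split by auto
      then show ?thesis using zy a cox_eq.trans by auto
    next
      case False
      let ?k = "gcomp (panel_groupoid \<W> s) j i"
      have el: "elem_homotopy S m \<W> (c, as @ [(s, j), (s, i)] @ fs) (c, as @ [(s, ?k)] @ fs)"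
        using elem_homotopy.compose_edges[OF gal False] .
      have "homot c ((as @ [(s, ?k)]) @ fs) gs"
        using homotopic_trans[OF homotopic_sym[OF elem_homotopy_homotopic[OF el]]] h by simp
      \<comment> \<open>The composed edge still has type s, so the new first part has the reduced
        type zs and the induction hypothesis yields a word for zsy.\<close>
      moreover have "path q [(s, ?k)] p"
        using panel_comp_edge[of s j i] False q(2) i unfolding path_single by auto
      then have "path c (as @ [(s, ?k)]) p" using q(1) path_append by blast
      ultimately obtain us where us: "subseq us (map fst gs)" "us \<simeq> z @ s # ?y"
        using Cons.IH[of "as @ [(s, ?k)]" p] p sy z(1) split by auto
      obtain b r b' where b: "us = b @ r # b'" "b @ b' \<simeq> z @ ?y"
        using red_middle_delete[OF z(1) sy(1) us(2)] .
      have "subseq (b @ b') us" unfolding b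
        by (intro list_emb_append_mono) (auto intro: list_emb_Cons)
      then have "subseq (b @ b') (map fst gs)" using us(1) subseq_order.order_trans by blast
      then show ?thesis using b zy a cox_eq.trans by auto
    qed
  qed
qed

lemma strict_W_groupoid_FG: "strict_W_groupoid S m FG (metrization S m \<W>)"
proof -
  let ?W = "coxeter_group S m" and ?\<delta> = "metrization S m \<W>"
  interpret F: groupoid FG by (rule groupoid_FG)
  show ?thesis
  proof unfold_locales
    show "?\<delta> \<in> edges FG \<rightarrow> carrier ?W"
      using metrization_cls word_elt_in_carrier path_types by (auto elim!: FG_edgeE)
  next
    fix C s assume "C \<in> verts FG" "s \<in> S"
    then obtain i d where i: "path C [(s, i)] d" using ex_edge by auto
    have "red [s]" using red_single \<open>s \<in> S\<close> by blast
    then have "?\<delta> (cls C [(s, i)]) = word_elt S m [s]" using metrization_cls[OF i] by simp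
    then show "\<exists>g\<in>edges FG. origin FG g = C \<and> ?\<delta> g = word_elt S m [s]"
      using i FG_origin FG_edge_iff by blast
  next
    fix v assume "v \<in> verts FG"
    then show "?\<delta> (gid FG v) = \<one>\<^bsub>?W\<^esub>"
      using metrization_cls[of v "[]" v] by (simp add: one_eq_word_elt red_iff)
  next
    fix g h assume "g \<in> edges FG" "h \<in> edges FG" and comp: "terminus FG g = origin FG h"
    then obtain c es d c' fs e where g: "path c es d" "red (map fst es)" "g = cls c es"
      and h: "path c' fs e" "red (map fst fs)" "h = cls c' fs"
      by (metis FG_edgeE)
    have "c' = d" using comp g h by (simp add: FG_origin FG_terminus)
    note h = h[unfolded this]
    have p: "path c (es @ fs) e" using g h path_append by blast
    obtain gs where gs: "path c gs e" "red (map fst gs)" "homot c (es @ fs) gs"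
      using homotopic_geodesic[OF p] by blast
    obtain us where us: "subseq us (map fst gs)" "us \<simeq> map fst es @ map fst fs"
      using concat_geodesics_subword[OF gs(1,2) g(1) h(1) g(2) h(2) gs(3)] by blast
    have "?\<delta> (gcomp FG g h) = word_elt S m (map fst gs)"
      using metrization_cls[OF gs(1,2)] cls_eqI[OF gs(3)] FG_gcomp g h by simp
    moreover have "?\<delta> g \<otimes>\<^bsub>?W\<^esub> ?\<delta> h = word_elt S m us"
      using us(2) cox_eq_in_lists[OF us(2)] g h
      by (simp add: metrization_cls word_elt_mult word_elt_eq_iff cox_eq.sym)
    ultimately show "bruhat_le S m (?\<delta> g \<otimes>\<^bsub>?W\<^esub> ?\<delta> h) (?\<delta> (gcomp FG g h))"
      unfolding bruhat_le_def using gs(2) us(1) by blast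
  next
    fix g s assume "g \<in> edges FG" "s \<in> S"
      and less: "bruhat_less S m (?\<delta> g \<otimes>\<^bsub>?W\<^esub> word_elt S m [s]) (?\<delta> g)"
    then obtain c es d where g: "path c es d" "red (map fst es)" "g = cls c es"
      by (metis FG_edgeE)
    let ?x = "map fst es"
    have x: "?x \<in> lists S" using path_types g by blast
    have mult: "?\<delta> g \<otimes>\<^bsub>?W\<^esub> word_elt S m [s] = word_elt S m (?x @ [s])"
      using g x \<open>s \<in> S\<close> by (simp add: metrization_cls word_elt_mult)
    then obtain ws us where ws: "red ws" "word_elt S m ws = word_elt S m ?x" "subseq us ws"
      "word_elt S m us = word_elt S m (?x @ [s])" "word_elt S m (?x @ [s]) \<noteq> word_elt S m ?x"
      using less g unfolding bruhat_less_def bruhat_le_def by (auto simp: metrization_cls)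
    have l: "ws \<in> lists S" using red_in_lists[OF ws(1)] .
    then have "us \<in> lists S" using list_emb_set[OF ws(3)] by (auto simp: in_lists_conv_set)
    note l = l this
    have "us \<simeq> ?x @ [s]" "ws \<simeq> ?x" using ws l x \<open>s \<in> S\<close> word_elt_eq_iff by simp_all
    \<comment> \<open>Equal lengths would make the subsequence \<open>us\<close> equal to
      \<open>ws\<close>, whereas the two represent different elements. So \<open>us\<close> is a
      word for xs shorter than x.\<close>
    moreover have "length us < length ws"
      using ws list_emb_length subseq_same_length by (metis le_neq_implies_less)
    moreover have "length ws \<le> length ?x"
      using ws(1) \<open>ws \<simeq> ?x\<close> cox_eq.sym unfolding red_iff by blast
    ultimately have "\<not> red (?x @ [s])" unfolding red_iff by fastforce
    then obtain y where y: "red (y @ [s])" "y @ [s] \<simeq> ?x"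
      using red_snocE[OF g(2) \<open>s \<in> S\<close>] by blast
    have ry: "red y" "red [s]" using red_infix[of "[]" y "[s]"] red_infix[of y "[s]" "[]"] y(1) by auto
    then have yl: "y \<in> lists S" using red_in_lists by blast
    have "braid ?x (y @ [s])" using matsumoto g(2) y cox_eq.sym by blast
    then obtain fs where fs: "path c fs d" "map fst fs = y @ [s]" "homot c es fs"
      using braid_lift g(1) by blast
    then obtain as i where split: "fs = as @ [(s, i)]" "map fst as = y"
      by (auto simp: map_eq_append_conv Cons_eq_map_conv)
    obtain p where p: "path c as p" "path p [(s, i)] d" using fs(1) split path_append by blast
    note inv = path_inv_path[OF p(1)]
    have pp: "path p [] p" "path d [] d" using path_chambers p by auto
    \<comment> \<open>The witness for (WG3) is the geodesic without its last edge, and h^-1 g is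
      then the class of that edge.\<close>
    let ?h = "cls c as"
    have h: "?h \<in> edges FG" "origin FG ?h = origin FG g"
      using p(1) g FG_edge_iff FG_origin by auto
    have "ginv FG ?h = cls p (inv_path as)"
      using F.ginv_eqI[OF h(1) FG_inverse[OF p(1)]] .
    moreover have "homot p (inv_path as @ as) []"
      using homotopic_inv_path[OF inv] inv_path_inv_path[OF p(1)] by simp
    then have "homot p ((inv_path as @ as) @ [(s, i)]) ([] @ [(s, i)])"
      using homotopic_append homotopic_refl inv p path_append by blast
    moreover have "g = cls c fs" using g(3) cls_eqI fs(3) by simp
    ultimately have "gcomp FG (ginv FG ?h) g = cls p [(s, i)]"
      using FG_gcomp[OF inv fs(1)] cls_eqI split by simp
    then have "?\<delta> (gcomp FG (ginv FG ?h) g) = word_elt S m [s]"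
      using metrization_cls[OF p(2)] ry by simp
    moreover have "?\<delta> ?h = word_elt S m (?x @ [s])"
    proof -
      have "?x @ [s] \<simeq> (y @ [s]) @ [s]"
        using y(2) \<open>s \<in> S\<close> by (intro cox_eq_append cox_eq.refl) (auto intro: cox_eq.sym)
      also have "(y @ [s]) @ [s] \<simeq> y"
        using cox_eq_delete[OF cox_eq_square, of s y "[]"] yl \<open>s \<in> S\<close> by simp
      finally show ?thesis
        using metrization_cls[OF p(1)] ry split word_elt_eq_iff yl x \<open>s \<in> S\<close> by (simp add: cox_eq.sym)
    qed
    ultimately show "\<exists>h\<in>edges FG. origin FG h = origin FG g \<and>
        ?\<delta> (gcomp FG (ginv FG h) g) = word_elt S m [s] \<and> ?\<delta> h = ?\<delta> g \<otimes>\<^bsub>?W\<^esub> word_elt S m [s]"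
      using h mult by auto
  next
    fix g assume "g \<in> edges FG" "?\<delta> g = \<one>\<^bsub>?W\<^esub>"
    then obtain c es d where g: "path c es d" "red (map fst es)" "g = cls c es"
      by (metis FG_edgeE)
    have "word_elt S m [] = word_elt S m (map fst es)"
      using \<open>?\<delta> g = \<one>\<^bsub>?W\<^esub>\<close> g by (simp add: metrization_cls one_eq_word_elt)
    then have "[] \<simeq> map fst es" using word_elt_eq_iff path_types g by simp
    \<comment> \<open>A reduced word for the identity is at most as long as the empty word.\<close>
    then have "es = []" using g(2) unfolding red_iff by fastforce
    then show "\<exists>v\<in>verts FG. g = gid FG v" using g path_chambers by auto
  qed
qed

end

theorem theorem5p17:
  fixes S :: "'s set" and m :: "'s \<Rightarrow> 's \<Rightarrow> enat" and \<W> :: "('s, 'c, 'e) weyl_data"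
  assumes "weyl_graph S m \<W>"
  shows "strict_W_groupoid S m (fundamental_groupoid S m \<W>) (metrization S m \<W>)"
  using weyl_graph.strict_W_groupoid_FG[OF assms] .

end
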